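(* Let $m>1$ be an integer and let $s\in\mathbb N$. The collection of functions $f_1,\ldots,f_s:\mathbb Z_m\to\mathbb Z_m$ given by $$f_1(x)=x,\quad f_2(x)=x^2,\quad \ldots,\quad f_s(x)=x^s$$ is uniform with each suffix.
   Context: $\mathbb N$ is the set of positive integers; $[N]=\{0,1,\ldots,N-1\}$. $\mathbb Z_m$ is the ring of $m$-adic integers (the inverse limit of the rings $\mathbb Z/m^n\mathbb Z$, $m$ not necessarily prime). For $x\in\mathbb Z_m$, $x\bmod m^n$ is the unique $y\in[m^n]$ with $x-y\in m^n\mathbb Z_m$. A function $f:\mathbb Z_m\to\mathbb Z_m$ is 1-Lipschitz if for all $n$, $x\bmod m^n=y\bmod m^n$ implies $f(x)\bmod m^n=f(y)\bmod m^n$; polynomials with integer coefficients are 1-Lipschitz. The probability space is $\Omega=\mathbb Z_m$ with Haar probability measure $\mathbb P$ (so $\mathbb P(a+m^k\mathbb Z_m)=m^{-k}$). Put $\xi_n(\omega)=\omega\bmod m^n$ for $\omega\in\mathbb Z_m$; it is uniformly distributed on $[m^n]$. For 1-Lipschitz functions $f_1,\ldots,f_s$ define the random vector in $[0,1)^s$ $$\varphi_n(f_1,\ldots,f_s)(\omega)=\left(\frac{f_1(\omega)\bmod m^n}{m^n},\ldots,\frac{f_s(\omega)\bmod m^n}{m^n}\right).$$ For $k\in\mathbb N$ and $\mathbf a=(a_1,\ldots,a_s)\in[m^k]^s$ let $J_k(\mathbf a)=\{(z_1,\ldots,z_s): \frac{a_i}{m^k}\le z_i<\frac{a_i+1}{m^k},\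 i=1,\ldots,s\}$, and let $V$ denote $s$-dimensional volume, so $V(J_k(\mathbf a))=m^{-ks}$. The collection $f_1,\ldots,f_s$ is called uniform with each suffix if for all $k,d\in\mathbb N$, $\mathbf a\in[m^k]^s$ and $\beta\in[m^d]$, $$\lim_{n\to\infty}\mathbb P\big(\varphi_n(f_1,\ldots,f_s)\in J_k(\mathbf a)\,\big|\,\xi_d=\beta\big)=V(J_k(\mathbf a)).$$ *)

theory Defs
  imports "HOL-Probability.Probability" "HOL-Algebra.Ring"
begin

section \<open>The ring of \<open>m\<close>-adic integers\<close>

text \<open>The inverse limit of the rings \<open>\<int> / m\<^sup>n \<int>\<close>: an element is a compatible sequence of residues,
  the \<open>n\<close>-th one being represented by its canonical representative in \<open>{0..<m ^ n}\<close>.\<close>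

definition zm_ring :: "int \<Rightarrow> (nat \<Rightarrow> int) ring" where
  "zm_ring m =
    \<lparr> carrier = {x. \<forall>n. x n \<in> {0..<m ^ n} \<and> x (Suc n) mod m ^ n = x n},
      mult = (\<lambda>x y n. (x n * y n) mod m ^ n),
      one = (\<lambda>n. 1 mod m ^ n),
      zero = (\<lambda>n. 0),
      add = (\<lambda>x y n. (x n + y n) mod m ^ n) \<rparr>"

definition zm_of_int :: "int \<Rightarrow> int \<Rightarrow> nat \<Rightarrow> int" where
  "zm_of_int m a = (\<lambda>n. a mod m ^ n)"

text \<open>\<open>x mod m\<^sup>n\<close> is the \<open>n\<close>-th component; \<open>zm_mod_eq_iff\<close> below shows that it is the
  unique \<open>y \<in> {0..<m ^ n}\<close> with \<open>x - y \<in> m\<^sup>n \<int>\<^sub>m\<close>.\<close>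

definition zm_mod :: "(nat \<Rightarrow> int) \<Rightarrow> nat \<Rightarrow> int" where
  "zm_mod x n = x n"

definition one_lipschitz :: "int \<Rightarrow> ((nat \<Rightarrow> int) \<Rightarrow> (nat \<Rightarrow> int)) \<Rightarrow> bool" where
  "one_lipschitz m f \<longleftrightarrow>
     f \<in> carrier (zm_ring m) \<rightarrow> carrier (zm_ring m) \<and>
     (\<forall>n. \<forall>x\<in>carrier (zm_ring m). \<forall>y\<in>carrier (zm_ring m).
        zm_mod x n = zm_mod y n \<longrightarrow> zm_mod (f x) n = zm_mod (f y) n)"

lemma zm_carrier_iff:
  "x \<in> carrier (zm_ring m) \<longleftrightarrow> (\<forall>n. x n \<in> {0..<m ^ n} \<and> x (Suc n) mod m ^ n = x n)"
  by (simp add: zm_ring_def)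

lemma zm_carrierD:
  assumes "x \<in> carrier (zm_ring m)"
  shows "0 \<le> x n" "x n < m ^ n" "x n mod m ^ n = x n" "x (Suc n) mod m ^ n = x n"
  using assms by (auto simp: zm_carrier_iff)

lemma zm_ops:
  "x \<oplus>\<^bsub>zm_ring m\<^esub> y = (\<lambda>n. (x n + y n) mod m ^ n)"
  "x \<otimes>\<^bsub>zm_ring m\<^esub> y = (\<lambda>n. (x n * y n) mod m ^ n)"
  "\<zero>\<^bsub>zm_ring m\<^esub> = (\<lambda>n. 0)"
  "\<one>\<^bsub>zm_ring m\<^esub> = (\<lambda>n. 1 mod m ^ n)"
  by (simp_all add: zm_ring_def)

lemma mod_pow_Suc: "a mod (m::int) ^ Suc n mod m ^ n = a mod m ^ n"
  by (simp add: mod_mod_cancel)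

lemma zm_carrier_modI:
  assumes "m > 1" and "\<And>n. F (Suc n) mod m ^ n = F n mod m ^ n"
  shows "(\<lambda>n. F n mod m ^ n) \<in> carrier (zm_ring m)"
  unfolding zm_carrier_iff
proof (intro allI conjI)
  fix n
  show "F n mod m ^ n \<in> {0..<m ^ n}" using assms(1) by simp
  show "F (Suc n) mod m ^ Suc n mod m ^ n = F n mod m ^ n"
    unfolding mod_pow_Suc by (rule assms(2))
qed

lemma zm_of_int_closed: "m > 1 \<Longrightarrow> zm_of_int m a \<in> carrier (zm_ring m)"
  unfolding zm_of_int_def by (rule zm_carrier_modI) auto

lemma zm_add_closed:
  assumes "m > 1" "x \<in> carrier (zm_ring m)" "y \<in> carrier (zm_ring m)"
  shows "x \<oplus>\<^bsub>zm_ring m\<^esub> y \<in> carrier (zm_ring m)"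
  unfolding zm_ops
proof (rule zm_carrier_modI[OF assms(1)])
  fix n
  show "(x (Suc n) + y (Suc n)) mod m ^ n = (x n + y n) mod m ^ n"
    by (metis mod_add_eq zm_carrierD(4) assms(2,3))
qed

lemma zm_mult_closed:
  assumes "m > 1" "x \<in> carrier (zm_ring m)" "y \<in> carrier (zm_ring m)"
  shows "x \<otimes>\<^bsub>zm_ring m\<^esub> y \<in> carrier (zm_ring m)"
  unfolding zm_ops
proof (rule zm_carrier_modI[OF assms(1)])
  fix n
  show "(x (Suc n) * y (Suc n)) mod m ^ n = (x n * y n) mod m ^ n"
    by (metis mod_mult_eq zm_carrierD(4) assms(2,3))
qed

lemma zm_uminus_closed:
  assumes "m > 1" "x \<in> carrier (zm_ring m)"
  shows "(\<lambda>n. (- x n) mod m ^ n) \<in> carrier (zm_ring m)"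
proof (rule zm_carrier_modI[OF assms(1)])
  fix n
  show "(- x (Suc n)) mod m ^ n = (- x n) mod m ^ n"
    by (metis mod_minus_eq zm_carrierD(4) assms(2))
qed

lemma zm_cring:
  assumes m: "m > 1"
  shows "cring (zm_ring m)"
proof (rule cringI)
  show "abelian_group (zm_ring m)"
  proof (rule abelian_groupI)
    show "\<zero>\<^bsub>zm_ring m\<^esub> \<in> carrier (zm_ring m)"
      using m by (simp add: zm_carrier_iff zm_ops)
    show "\<exists>y\<in>carrier (zm_ring m). y \<oplus>\<^bsub>zm_ring m\<^esub> x = \<zero>\<^bsub>zm_ring m\<^esub>"
      if "x \<in> carrier (zm_ring m)" for x
      by (rule bexI[OF _ zm_uminus_closed[OF m that]]) (simp add: zm_ops mod_simps)
    show "\<zero>\<^bsub>zm_ring m\<^esub> \<oplus>\<^bsub>zm_ring m\<^esub> x = x" if "x \<in> carrier (zm_ring m)" for x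
      using zm_carrierD[OF that] by (simp add: zm_ops)
  qed (auto simp: zm_add_closed m, auto simp: zm_ops mod_simps ac_simps)
  show "comm_monoid (zm_ring m)"
  proof (rule comm_monoidI)
    show "\<one>\<^bsub>zm_ring m\<^esub> \<in> carrier (zm_ring m)"
      using zm_of_int_closed[OF m, of 1] by (simp add: zm_of_int_def zm_ops)
    show "\<one>\<^bsub>zm_ring m\<^esub> \<otimes>\<^bsub>zm_ring m\<^esub> x = x" if "x \<in> carrier (zm_ring m)" for x
      using zm_carrierD[OF that] by (simp add: zm_ops mod_simps)
  qed (auto simp: zm_mult_closed m, auto simp: zm_ops mod_simps ac_simps)
qed (auto simp: zm_ops mod_simps algebra_simps)

lemma zm_minus:
  assumes m: "m > 1" and x: "x \<in> carrier (zm_ring m)" and y: "y \<in> carrier (zm_ring m)"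
  shows "x \<ominus>\<^bsub>zm_ring m\<^esub> y = (\<lambda>n. (x n - y n) mod m ^ n)"
proof -
  interpret cring "zm_ring m" by (rule zm_cring[OF m])
  have "\<ominus>\<^bsub>zm_ring m\<^esub> y = (\<lambda>n. (- y n) mod m ^ n)"
    by (rule minus_equality[OF _ y zm_uminus_closed[OF m y]]) (simp add: zm_ops mod_simps)
  then show ?thesis by (simp add: a_minus_def zm_ops mod_simps)
qed

lemma zm_pow:
  assumes m: "m > 1" and x: "x \<in> carrier (zm_ring m)"
  shows "x [^]\<^bsub>zm_ring m\<^esub> (i::nat) = (\<lambda>n. (x n) ^ i mod m ^ n)"
proof -
  interpret cring "zm_ring m" by (rule zm_cring[OF m])
  show ?thesis by (induction i) (auto simp: zm_ops mod_simps ac_simps)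
qed

lemma zm_pow_one_lipschitz:
  assumes m: "m > 1"
  shows "one_lipschitz m (\<lambda>x. x [^]\<^bsub>zm_ring m\<^esub> (i::nat))"
proof -
  interpret cring "zm_ring m" by (rule zm_cring[OF m])
  show ?thesis by (auto simp: one_lipschitz_def zm_mod_def) (simp add: zm_pow[OF m])
qed

lemma zm_mod_mod:
  assumes x: "x \<in> carrier (zm_ring m)" and "n \<le> k"
  shows "x k mod m ^ n = x n"
  using \<open>n \<le> k\<close>
proof (induction k rule: dec_induct)
  case base
  show ?case by (rule zm_carrierD[OF x])
next
  case (step k)
  have "x (Suc k) mod m ^ n = x (Suc k) mod m ^ k mod m ^ n"
    using step.hyps by (simp add: mod_mod_cancel le_imp_power_dvd)
  then show ?case using step zm_carrierD(4)[OF x] by simp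
qed

lemma zm_mod_eq_iff:
  assumes m: "m > 1" and x: "x \<in> carrier (zm_ring m)" and y: "y \<in> {0..<m ^ n}"
  shows "zm_mod x n = y \<longleftrightarrow>
    (\<exists>z\<in>carrier (zm_ring m). x \<ominus>\<^bsub>zm_ring m\<^esub> zm_of_int m y = zm_of_int m (m ^ n) \<otimes>\<^bsub>zm_ring m\<^esub> z)"
proof
  assume "\<exists>z\<in>carrier (zm_ring m). x \<ominus>\<^bsub>zm_ring m\<^esub> zm_of_int m y = zm_of_int m (m ^ n) \<otimes>\<^bsub>zm_ring m\<^esub> z"
  then obtain z where "x \<ominus>\<^bsub>zm_ring m\<^esub> zm_of_int m y = zm_of_int m (m ^ n) \<otimes>\<^bsub>zm_ring m\<^esub> z" by blast
  from fun_cong[OF this, of n] have "(x n - y) mod m ^ n = 0"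
    by (simp add: zm_minus[OF m x zm_of_int_closed[OF m]])
       (simp add: zm_ops zm_of_int_def mod_simps)
  then have "x n mod m ^ n = y mod m ^ n" by (simp add: mod_eq_dvd_iff mod_eq_0_iff_dvd)
  then show "zm_mod x n = y" using y zm_carrierD(3)[OF x] by (simp add: zm_mod_def)
next
  assume xy: "zm_mod x n = y"
  define w where "w = x \<ominus>\<^bsub>zm_ring m\<^esub> zm_of_int m y"
  interpret cring "zm_ring m" by (rule zm_cring[OF m])
  have w: "w \<in> carrier (zm_ring m)" unfolding w_def using x zm_of_int_closed[OF m] by simp
  have w0: "w n = 0" unfolding w_def using xy y
    by (simp add: zm_minus[OF m x zm_of_int_closed[OF m]]) (simp add: zm_of_int_def zm_mod_def)
  have dvd: "m ^ n dvd w (n + k)" for k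
    using zm_mod_mod[OF w, of n "n + k"] w0 by (simp add: mod_eq_0_iff_dvd)
  define z where "z = (\<lambda>k. w (n + k) div m ^ n)"
  have wz: "w (n + k) = m ^ n * z k" for k using dvd by (simp add: z_def)
  have "z \<in> carrier (zm_ring m)"
    unfolding zm_carrier_iff
  proof (intro allI conjI)
    fix k
    have mn: "0 < m ^ n" using m by simp
    have "0 \<le> m ^ n * z k" "m ^ n * z k < m ^ n * m ^ k"
      using zm_carrierD(1,2)[OF w, of "n + k"] by (simp_all add: wz power_add)
    then show "z k \<in> {0..<m ^ k}" using mn by (simp add: zero_le_mult_iff)
    have "m ^ n * (z (Suc k) mod m ^ k) = (m ^ n * z (Suc k)) mod (m ^ n * m ^ k)"
      by (rule mult_mod_right)
    also have "\<dots> = w (Suc (n + k)) mod m ^ (n + k)" using wz[of "Suc k"] by (simp add: power_add)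
    also have "\<dots> = m ^ n * z k" using zm_carrierD(4)[OF w] wz by simp
    finally show "z (Suc k) mod m ^ k = z k" using mn m by simp
  qed
  moreover have "w = zm_of_int m (m ^ n) \<otimes>\<^bsub>zm_ring m\<^esub> z"
  proof
    fix k
    have "w k = w (n + k) mod m ^ k" using zm_mod_mod[OF w, of k "n + k"] by simp
    then show "w k = (zm_of_int m (m ^ n) \<otimes>\<^bsub>zm_ring m\<^esub> z) k"
      by (simp add: zm_ops zm_of_int_def wz mod_simps)
  qed
  ultimately show "\<exists>z\<in>carrier (zm_ring m). x \<ominus>\<^bsub>zm_ring m\<^esub> zm_of_int m y = zm_of_int m (m ^ n) \<otimes>\<^bsub>zm_ring m\<^esub> z"
    unfolding w_def by blast
qed


section \<open>Haar probability measure\<close>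

text \<open>The inverse limit topology.\<close>

definition zm_topology :: "int \<Rightarrow> (nat \<Rightarrow> int) topology" where
  "zm_topology m =
     subtopology (product_topology (\<lambda>n. discrete_topology {0..<m ^ n}) UNIV) (carrier (zm_ring m))"

definition is_haar_probability :: "int \<Rightarrow> (nat \<Rightarrow> int) measure \<Rightarrow> bool" where
  "is_haar_probability m P \<longleftrightarrow>
     prob_space P \<and>
     space P = carrier (zm_ring m) \<and>
     sets P = sigma_sets (carrier (zm_ring m)) {U. openin (zm_topology m) U} \<and>
     (\<forall>a\<in>carrier (zm_ring m). \<forall>A\<in>sets P.
        emeasure P ((\<lambda>x. a \<oplus>\<^bsub>zm_ring m\<^esub> x) ` A) = emeasure P A)"

text \<open>Existence and uniqueness are \<open>ex1_haar_probability\<close> below.\<close>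

definition haar_probability :: "int \<Rightarrow> (nat \<Rightarrow> int) measure" where
  "haar_probability m = (THE P. is_haar_probability m P)"

definition zm_ball :: "int \<Rightarrow> nat \<Rightarrow> int \<Rightarrow> (nat \<Rightarrow> int) set" where
  "zm_ball m n c = {x \<in> carrier (zm_ring m). zm_mod x n = c}"

definition zm_balls :: "int \<Rightarrow> (nat \<Rightarrow> int) set set" where
  "zm_balls m = (\<lambda>(n, c). zm_ball m n c) ` (UNIV \<times> UNIV)"

lemma zm_ball_in_balls [simp]: "zm_ball m n c \<in> zm_balls m"
  by (auto simp: zm_balls_def)

lemma zm_balls_subset: "zm_balls m \<subseteq> Pow (carrier (zm_ring m))"
  by (auto simp: zm_balls_def zm_ball_def)

lemma openin_zm_ball: "openin (zm_topology m) (zm_ball m n c)"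
proof -
  let ?X = "product_topology (\<lambda>n. discrete_topology {0..<m ^ n}) UNIV"
  have "openin ?X {x \<in> topspace ?X. x n \<in> {c} \<inter> {0..<m ^ n}}"
    by (rule openin_continuous_map_preimage[OF continuous_map_product_projection]) auto
  then show ?thesis
    unfolding zm_topology_def openin_subtopology
    by (rule_tac exI[of _ "{x \<in> topspace ?X. x n \<in> {c} \<inter> {0..<m ^ n}}"])
       (auto simp: zm_ball_def zm_mod_def zm_carrier_iff)
qed

lemma zm_open_ball:
  assumes U: "openin (zm_topology m) U" and x: "x \<in> U"
  shows "\<exists>n. zm_ball m n (x n) \<subseteq> U"
proof -
  let ?X = "product_topology (\<lambda>n. discrete_topology {0..<m ^ n}) UNIV"
  from U obtain T where T: "openin ?X T" "U = T \<inter> carrier (zm_ring m)"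
    unfolding zm_topology_def openin_subtopology by blast
  with x have "x \<in> T" by simp
  with T(1) obtain V where V: "finite {i. V i \<noteq> {0..<m ^ i}}" "x \<in> Pi\<^sub>E UNIV V" "Pi\<^sub>E UNIV V \<subseteq> T"
    unfolding openin_product_topology_alt by fastforce
  define n where "n = Max (insert 0 {i. V i \<noteq> {0..<m ^ i}})"
  have n: "i \<le> n" if "V i \<noteq> {0..<m ^ i}" for i
    unfolding n_def using V(1) that by (intro Max_ge) auto
  have "y \<in> U" if y: "y \<in> carrier (zm_ring m)" "y n = x n" for y
  proof -
    have xc: "x \<in> carrier (zm_ring m)" using x T by simp
    have "y i \<in> V i" for i
    proof (cases "V i = {0..<m ^ i}")
      case True
      then show ?thesis using y(1) by (simp add: zm_carrier_iff)
    next
      case False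
      then have "y i = x i" using n zm_mod_mod[OF xc, of i n] zm_mod_mod[OF y(1), of i n] y(2) by simp
      then show ?thesis using V(2) by auto
    qed
    then show ?thesis using V(3) T(2) y(1) by auto
  qed
  then show ?thesis by (auto simp: zm_ball_def zm_mod_def)
qed

lemma countable_zm_balls: "countable (zm_balls m)"
  unfolding zm_balls_def by simp

lemma zm_sets_eq_balls:
  "sigma_sets (carrier (zm_ring m)) {U. openin (zm_topology m) U} =
   sigma_sets (carrier (zm_ring m)) (zm_balls m)"
proof (rule sigma_sets_eqI)
  fix U assume "U \<in> {U. openin (zm_topology m) U}"
  then have U: "openin (zm_topology m) U" by simp
  have Uc: "U \<subseteq> carrier (zm_ring m)"
    using openin_subset[OF U] by (auto simp: zm_topology_def)
  have "U = \<Union> {B \<in> zm_balls m. B \<subseteq> U}"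
  proof
    show "U \<subseteq> \<Union> {B \<in> zm_balls m. B \<subseteq> U}"
    proof
      fix x assume x: "x \<in> U"
      from zm_open_ball[OF U x] obtain n where "zm_ball m n (x n) \<subseteq> U" by blast
      moreover have "x \<in> zm_ball m n (x n)" using x Uc by (auto simp: zm_ball_def zm_mod_def)
      ultimately show "x \<in> \<Union> {B \<in> zm_balls m. B \<subseteq> U}" using zm_ball_in_balls by blast
    qed
  qed auto
  moreover have "countable {B \<in> zm_balls m. B \<subseteq> U}"
    by (rule countable_subset[OF _ countable_zm_balls[of m]]) auto
  moreover have "{B \<in> zm_balls m. B \<subseteq> U} \<subseteq> sigma_sets (carrier (zm_ring m)) (zm_balls m)"
    by auto
  ultimately show "U \<in> sigma_sets (carrier (zm_ring m)) (zm_balls m)"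
    by (metis (no_types, lifting) sigma_sets_UNION subset_iff)
next
  fix B assume "B \<in> zm_balls m"
  then show "B \<in> sigma_sets (carrier (zm_ring m)) {U. openin (zm_topology m) U}"
    by (auto simp: zm_balls_def openin_zm_ball)
qed

lemma zm_ball_Int:
  "zm_ball m n c \<inter> zm_ball m k d \<in> insert {} (zm_balls m)"
proof -
  have *: "zm_ball m n c \<inter> zm_ball m k d \<in> {{}, zm_ball m k d}" if "n \<le> k" for n k c d
  proof -
    have "x n = d mod m ^ n" if "x \<in> zm_ball m k d" for x
    proof -
      have "x \<in> carrier (zm_ring m)" "x k = d"
        using that by (simp_all add: zm_ball_def zm_mod_def)
      then show ?thesis using zm_mod_mod[OF _ \<open>n \<le> k\<close>, of x m] by simp
    qed
    then have "zm_ball m n c \<inter> zm_ball m k d = (if d mod m ^ n = c then zm_ball m k d else {})"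
      by (auto simp: zm_ball_def zm_mod_def)
    then show ?thesis by simp
  qed
  show ?thesis
  proof (cases "n \<le> k")
    case True
    from *[OF this, of c d] show ?thesis by auto
  next
    case False
    then have "k \<le> n" by simp
    from *[OF this, of d c] show ?thesis by (auto simp: Int_commute)
  qed
qed

lemma zm_ball_outside: "c \<notin> {0..<m ^ n} \<Longrightarrow> zm_ball m n c = {}"
  unfolding zm_ball_def zm_mod_def zm_carrier_iff by blast

lemma zm_ball_empty: "zm_ball m n (-1) = {}"
  by (rule zm_ball_outside) simp

lemma zm_ball_0: "zm_ball m 0 0 = carrier (zm_ring m)"
proof -
  have "x 0 = 0" if "x \<in> carrier (zm_ring m)" for x
    using zm_carrierD(1,2)[OF that, of 0] by simp
  then show ?thesis by (auto simp: zm_ball_def zm_mod_def)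
qed

lemma Int_stable_zm_balls: "Int_stable (zm_balls m)"
proof -
  have e: "{} \<in> zm_balls m" using zm_ball_in_balls[of m 0 "-1"] unfolding zm_ball_empty .
  show ?thesis
    unfolding Int_stable_def
  proof (intro ballI)
    fix A B assume "A \<in> zm_balls m" "B \<in> zm_balls m"
    then obtain n c k d where "A = zm_ball m n c" "B = zm_ball m k d"
      by (auto simp: zm_balls_def)
    then show "A \<inter> B \<in> zm_balls m" using zm_ball_Int[of m n c k d] e by auto
  qed
qed

lemma zm_measure_eqI:
  assumes "prob_space P" "sets P = sigma_sets (carrier (zm_ring m)) (zm_balls m)"
    and "sets Q = sigma_sets (carrier (zm_ring m)) (zm_balls m)"
    and "\<And>n c. emeasure P (zm_ball m n c) = emeasure Q (zm_ball m n c)"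
  shows "P = Q"
proof (rule measure_eqI_generator_eq[OF Int_stable_zm_balls zm_balls_subset _ assms(2,3)])
  show "emeasure P X = emeasure Q X" if "X \<in> zm_balls m" for X
    using that assms(4) by (auto simp: zm_balls_def)
  show "range (\<lambda>_::nat. zm_ball m 0 0) \<subseteq> zm_balls m" by auto
  show "(\<Union>i::nat. zm_ball m 0 0) = carrier (zm_ring m)" by (simp add: zm_ball_0)
  interpret prob_space P by fact
  show "emeasure P (zm_ball m 0 0) \<noteq> \<infinity>" by simp
qed

lemma zm_translate_ball:
  assumes m: "m > 1" and a: "a \<in> carrier (zm_ring m)" and c: "c \<in> {0..<m ^ n}"
  shows "(\<lambda>x. a \<oplus>\<^bsub>zm_ring m\<^esub> x) ` zm_ball m n c = zm_ball m n ((a n + c) mod m ^ n)"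
proof -
  interpret cring "zm_ring m" by (rule zm_cring[OF m])
  have ball: "x \<in> zm_ball m n e \<longleftrightarrow> x \<in> carrier (zm_ring m) \<and> x n = e" for x e
    by (simp add: zm_ball_def zm_mod_def)
  have add: "(a \<oplus>\<^bsub>zm_ring m\<^esub> x) n = (a n + x n) mod m ^ n" for x
    by (simp add: zm_ops)
  show ?thesis
  proof (intro equalityI subsetI)
    fix y assume "y \<in> (\<lambda>x. a \<oplus>\<^bsub>zm_ring m\<^esub> x) ` zm_ball m n c"
    then obtain x where "x \<in> zm_ball m n c" and y: "y = a \<oplus>\<^bsub>zm_ring m\<^esub> x"
      by (rule imageE)
    then have x: "x \<in> carrier (zm_ring m)" "x n = c" by (simp_all only: ball)
    show "y \<in> zm_ball m n ((a n + c) mod m ^ n)"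
      unfolding ball y add x(2) using a x(1) by (intro conjI a_closed refl)
  next
    fix y assume "y \<in> zm_ball m n ((a n + c) mod m ^ n)"
    then have y: "y \<in> carrier (zm_ring m)" "y n = (a n + c) mod m ^ n" by (simp_all only: ball)
    have "(y \<ominus>\<^bsub>zm_ring m\<^esub> a) n = (y n - a n) mod m ^ n"
      unfolding zm_minus[OF m y(1) a] by (rule refl)
    also have "\<dots> = (a n + c - a n) mod m ^ n" unfolding y(2) by (rule mod_diff_left_eq)
    also have "\<dots> = c" using c by simp
    finally have "y \<ominus>\<^bsub>zm_ring m\<^esub> a \<in> zm_ball m n c"
      unfolding ball using minus_closed[OF y(1) a] by blast
    moreover have "y = a \<oplus>\<^bsub>zm_ring m\<^esub> (y \<ominus>\<^bsub>zm_ring m\<^esub> a)"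
      using a_lcomm[OF a y(1) a_inv_closed[OF a]] y(1) unfolding a_minus_def r_neg[OF a] by (metis r_zero)
    ultimately show "y \<in> (\<lambda>x. a \<oplus>\<^bsub>zm_ring m\<^esub> x) ` zm_ball m n c" by blast
  qed
qed

lemma haar_probability_ball:
  assumes m: "m > 1" and P: "is_haar_probability m P" and c: "c \<in> {0..<m ^ n}"
  shows "measure P (zm_ball m n c) = 1 / real_of_int m ^ n"
proof -
  interpret prob_space P using P by (simp add: is_haar_probability_def)
  have sp: "space P = carrier (zm_ring m)" using P by (simp add: is_haar_probability_def)
  have sets: "zm_ball m n d \<in> sets P" for d
    using P by (simp add: is_haar_probability_def openin_zm_ball)
  have eq: "measure P (zm_ball m n d) = measure P (zm_ball m n 0)" if d: "d \<in> {0..<m ^ n}" for d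
  proof -
    have z: "0 \<in> {0..<m ^ n}" using m by simp
    have "emeasure P ((\<lambda>x. zm_of_int m d \<oplus>\<^bsub>zm_ring m\<^esub> x) ` zm_ball m n 0) = emeasure P (zm_ball m n 0)"
      using P sets zm_of_int_closed[OF m] by (simp add: is_haar_probability_def)
    then show ?thesis
      unfolding zm_translate_ball[OF m zm_of_int_closed[OF m] z]
      using d by (simp add: zm_of_int_def measure_def)
  qed
  have "space P = (\<Union>d\<in>{0..<m ^ n}. zm_ball m n d)"
  proof (intro equalityI subsetI)
    fix x assume "x \<in> space P"
    then have "x n \<in> {0..<m ^ n}" "x \<in> zm_ball m n (x n)"
      unfolding sp by (simp_all add: zm_ball_def zm_mod_def zm_carrierD)
    then show "x \<in> (\<Union>d\<in>{0..<m ^ n}. zm_ball m n d)" by (rule UN_I)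
  qed (auto simp: sp zm_ball_def)
  then have "1 = measure P (\<Union>d\<in>{0..<m ^ n}. zm_ball m n d)"
    using prob_space by simp
  also have "\<dots> = (\<Sum>d\<in>{0..<m ^ n}. measure P (zm_ball m n d))"
    using sets by (intro finite_measure_finite_Union) (auto simp: disjoint_family_on_def zm_ball_def)
  also have "\<dots> = (\<Sum>d\<in>{0..<m ^ n}. measure P (zm_ball m n 0))"
    by (rule sum.cong[OF refl eq])
  also have "\<dots> = real_of_int m ^ n * measure P (zm_ball m n 0)" using m by simp
  finally show ?thesis using eq[OF c] m by (simp add: field_simps)
qed

text \<open>Existence: independent uniformly distributed base-\<open>m\<close> digits.\<close>

lemma ex_zm_uniform_measure:
  fixes m :: int
  assumes m: "m > 1"
  obtains P where "prob_space P" "space P = carrier (zm_ring m)"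
    "sets P = sigma_sets (carrier (zm_ring m)) (zm_balls m)"
    "\<And>n c. c \<in> {0..<m ^ n} \<Longrightarrow> emeasure P (zm_ball m n c) = ennreal (1 / real_of_int m ^ n)"
proof -
  define D where "D = uniform_count_measure {0..<m}"
  have D: "prob_space D" unfolding D_def using m by (intro prob_space_uniform_count_measure) auto
  interpret D: prob_space D by (rule D)
  interpret M: product_prob_space "\<lambda>_::nat. D" UNIV by unfold_locales
  let ?M = "PiM (UNIV::nat set) (\<lambda>_. D)"
  have spD: "space D = {0..<m}" by (simp add: D_def space_uniform_count_measure)
  have spM: "d \<in> space ?M \<longleftrightarrow> (\<forall>i. 0 \<le> d i \<and> d i < m)" for d
    by (auto simp: space_PiM spD PiE_UNIV_domain Pi_iff)
  define g where "g = (\<lambda>(d::nat \<Rightarrow> int) n. \<Sum>i<n. d i * m ^ i)"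
  have g_bound: "0 \<le> g d n \<and> g d n < m ^ n" if d: "d \<in> space ?M" for d n
  proof (induction n)
    case (Suc n)
    have "d n * m ^ n \<le> (m - 1) * m ^ n"
      using d m unfolding spM by (intro mult_right_mono) (auto simp: int_one_le_iff_zero_less intro: order.trans)
    moreover have "0 \<le> d n * m ^ n" using d m by (simp add: spM)
    ultimately show ?case using Suc by (simp add: g_def algebra_simps)
  qed (simp add: g_def)
  have g_Suc: "g d (Suc n) = g d n + d n * m ^ n" for d n by (simp add: g_def)
  have g_mod: "g d (Suc n) mod m ^ n = g d n" if "d \<in> space ?M" for d n
    using g_bound[OF that, of n] by (simp add: g_Suc)
  have g_div: "g d (Suc n) div m ^ n = d n" if "d \<in> space ?M" for d n
    using g_bound[OF that, of n] m by (simp add: g_Suc)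
  have g_carrier: "g d \<in> carrier (zm_ring m)" if "d \<in> space ?M" for d
    using g_bound[OF that] g_mod[OF that] by (simp add: zm_carrier_iff)
  define dig where "dig = (\<lambda>(c::int) i. c div m ^ i mod m)"
  have g_eq: "g d n = c \<longleftrightarrow> (\<forall>i<n. d i = dig c i)" if d: "d \<in> space ?M" and c: "c \<in> {0..<m ^ n}" for d n c
    using c
  proof (induction n arbitrary: c)
    case 0
    then show ?case by (auto simp: g_def)
  next
    case (Suc n)
    have mn: "m ^ n > 0" using m by simp
    have c': "c mod m ^ n \<in> {0..<m ^ n}" using mn by simp
    have dn: "dig c n = c div m ^ n"
    proof -
      have "0 \<le> c div m ^ n" using Suc.prems mn by (simp add: pos_imp_zdiv_nonneg_iff)
      moreover have "c div m ^ n < m"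
      proof (rule ccontr)
        assume "\<not> c div m ^ n < m"
        then have "m * m ^ n \<le> (c div m ^ n) * m ^ n" using mn by (intro mult_right_mono) auto
        also have "\<dots> = c - c mod m ^ n" by (rule minus_mod_eq_div_mult[symmetric])
        also have "\<dots> \<le> c" using c' by simp
        finally show False using Suc.prems by simp
      qed
      ultimately show ?thesis by (simp add: dig_def)
    qed
    have di: "dig (c mod m ^ n) i = dig c i" if "i < n" for i
    proof -
      have "n = i + (n - i)" using that by simp
      then have mm: "m ^ n = m ^ i * m ^ (n - i)" by (metis power_add)
      have "c mod m ^ n div m ^ i = c div m ^ i mod m ^ (n - i)"
        unfolding mm using m by (simp add: zmod_zmult2_eq)
      moreover have "m dvd m ^ (n - i)" using that by (simp add: dvd_power)
      ultimately show ?thesis by (simp add: dig_def mod_mod_cancel)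
    qed
    have "g d (Suc n) = c \<longleftrightarrow> g d (Suc n) mod m ^ n = c mod m ^ n \<and> g d (Suc n) div m ^ n = c div m ^ n"
      by (metis mult_div_mod_eq)
    also have "\<dots> \<longleftrightarrow> g d n = c mod m ^ n \<and> d n = dig c n"
      using g_mod[OF d] g_div[OF d] dn by simp
    also have "\<dots> \<longleftrightarrow> (\<forall>i<n. d i = dig c i) \<and> d n = dig c n"
      using Suc.IH[OF c'] di by auto
    finally show ?case by (auto simp: less_Suc_eq)
  qed
  let ?S = "sigma (carrier (zm_ring m)) (zm_balls m)"
  have sets_S: "sets ?S = sigma_sets (carrier (zm_ring m)) (zm_balls m)"
    using zm_balls_subset by simp
  have pre: "g -` zm_ball m n c \<inter> space ?M = {d \<in> space ?M. \<forall>i\<in>{..<n}. d i \<in> {dig c i}}"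
    if "c \<in> {0..<m ^ n}" for n c
    using g_eq[OF _ that] g_carrier by (auto simp: zm_ball_def zm_mod_def)
  have dig_range: "dig c i \<in> {0..<m}" for c i using m by (simp add: dig_def)
  have single: "{dig c i} \<in> sets D" for c i
    using dig_range[of c i] by (simp add: D_def sets_uniform_count_measure)
  have pre_sets: "g -` zm_ball m n c \<inter> space ?M \<in> sets ?M" for n c
  proof (cases "c \<in> {0..<m ^ n}")
    case True
    have "{d \<in> space ?M. \<forall>i\<in>{..<n}. d i \<in> {dig c i}} \<in> sets ?M"
      by (intro sets.sets_Collect_finite_All sets_Collect_single single finite_lessThan UNIV_I)
    then show ?thesis using pre[OF True] by simp
  next
    case False
    then show ?thesis by (simp add: zm_ball_outside)
  qed
  have g_meas: "g \<in> ?M \<rightarrow>\<^sub>M ?S"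
  proof (rule measurable_measure_of[OF zm_balls_subset])
    show "g \<in> space ?M \<rightarrow> carrier (zm_ring m)" using g_carrier by auto
    show "g -` A \<inter> space ?M \<in> sets ?M" if "A \<in> zm_balls m" for A
      using that pre_sets by (auto simp: zm_balls_def)
  qed
  show ?thesis
  proof (rule that[of "distr ?M ?S g"])
    show "prob_space (distr ?M ?S g)" by (rule M.P.prob_space_distr[OF g_meas])
    show "space (distr ?M ?S g) = carrier (zm_ring m)"
      using zm_balls_subset by (simp add: space_measure_of)
    show "sets (distr ?M ?S g) = sigma_sets (carrier (zm_ring m)) (zm_balls m)"
      using sets_S by simp
    fix n c assume c: "c \<in> {0..<m ^ n}"
    have "zm_ball m n c \<in> sets ?S" unfolding sets_S by auto
    then have "emeasure (distr ?M ?S g) (zm_ball m n c) = emeasure ?M (g -` zm_ball m n c \<inter> space ?M)"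
      by (rule emeasure_distr[OF g_meas])
    also have "\<dots> = (\<Prod>i<n. emeasure D {dig c i})"
      unfolding pre[OF c] using single by (intro M.emeasure_PiM_Collect) auto
    also have "\<dots> = (\<Prod>i<n. ennreal (1 / real_of_int m))"
      using dig_range m unfolding D_def
      by (intro prod.cong refl, subst emeasure_uniform_count_measure) auto
    also have "\<dots> = ennreal (1 / real_of_int m ^ n)"
      using m by (simp add: ennreal_power power_one_over)
    finally show "emeasure (distr ?M ?S g) (zm_ball m n c) = ennreal (1 / real_of_int m ^ n)" .
  qed
qed

lemma ex1_haar_probability:
  assumes m: "m > 1"
  shows "\<exists>!P. is_haar_probability m P"
proof -
  interpret cring "zm_ring m" by (rule zm_cring[OF m])
  obtain P where P: "prob_space P" "space P = carrier (zm_ring m)"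
    "sets P = sigma_sets (carrier (zm_ring m)) (zm_balls m)"
    and ball: "\<And>n c. c \<in> {0..<m ^ n} \<Longrightarrow> emeasure P (zm_ball m n c) = ennreal (1 / real_of_int m ^ n)"
    using ex_zm_uniform_measure[OF m] by blast
  interpret P: prob_space P by (rule P)
  have translate: "emeasure P ((\<lambda>x. a \<oplus>\<^bsub>zm_ring m\<^esub> x) ` A) = emeasure P A"
    if a: "a \<in> carrier (zm_ring m)" and A: "A \<in> sets P" for a A
  proof -
    let ?t = "\<lambda>x. (\<ominus>\<^bsub>zm_ring m\<^esub> a) \<oplus>\<^bsub>zm_ring m\<^esub> x"
    have pre: "?t -` B \<inter> space P = (\<lambda>x. a \<oplus>\<^bsub>zm_ring m\<^esub> x) ` B" if "B \<subseteq> carrier (zm_ring m)" for B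
    proof (intro equalityI subsetI)
      fix x assume "x \<in> ?t -` B \<inter> space P"
      then have "?t x \<in> B" "x = a \<oplus>\<^bsub>zm_ring m\<^esub> ?t x"
        using a by (auto simp: P r_neg2)
      then show "x \<in> (\<lambda>x. a \<oplus>\<^bsub>zm_ring m\<^esub> x) ` B" by blast
    qed (use that a in \<open>auto simp: P r_neg1\<close>)
    have pre_ball: "?t -` zm_ball m n c \<inter> space P \<in> sets P \<and>
      emeasure P (?t -` zm_ball m n c \<inter> space P) = emeasure P (zm_ball m n c)" for n c
    proof (cases "c \<in> {0..<m ^ n}")
      case True
      have "zm_ball m n c \<subseteq> carrier (zm_ring m)" by (auto simp: zm_ball_def)
      then have "?t -` zm_ball m n c \<inter> space P = zm_ball m n ((a n + c) mod m ^ n)"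
        using pre zm_translate_ball[OF m a True] by simp
      moreover have "(a n + c) mod m ^ n \<in> {0..<m ^ n}" using m by simp
      ultimately show ?thesis using ball True P(3) by auto
    next
      case False
      then show ?thesis by (simp add: zm_ball_outside)
    qed
    have t: "?t \<in> P \<rightarrow>\<^sub>M P"
      by (rule measurable_sigma_sets[OF P(3) zm_balls_subset])
         (use a pre_ball in \<open>auto simp: P zm_balls_def\<close>)
    have "P = distr P P ?t"
    proof (rule zm_measure_eqI[OF P(1,3)])
      show "sets (distr P P ?t) = sigma_sets (carrier (zm_ring m)) (zm_balls m)" using P by simp
      have "zm_ball m n c \<in> sets P" for n c unfolding P by auto
      then show "emeasure P (zm_ball m n c) = emeasure (distr P P ?t) (zm_ball m n c)" for n c
        using pre_ball by (simp add: emeasure_distr[OF t])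
    qed
    then have "emeasure P A = emeasure (distr P P ?t) A" by simp
    also have "\<dots> = emeasure P (?t -` A \<inter> space P)" by (rule emeasure_distr[OF t A])
    also have "?t -` A \<inter> space P = (\<lambda>x. a \<oplus>\<^bsub>zm_ring m\<^esub> x) ` A"
      using sets.sets_into_space[OF A] P by (intro pre) simp
    finally show ?thesis by simp
  qed
  show ?thesis
  proof (rule ex1I[of _ P])
    show hP: "is_haar_probability m P"
      unfolding is_haar_probability_def zm_sets_eq_balls using P translate by simp
    fix Q assume Q: "is_haar_probability m Q"
    interpret Q: prob_space Q using Q by (simp add: is_haar_probability_def)
    show "Q = P"
    proof (rule zm_measure_eqI[of _ m])
      show "prob_space Q" by unfold_locales
      show "sets Q = sigma_sets (carrier (zm_ring m)) (zm_balls m)"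
        using Q by (simp add: is_haar_probability_def zm_sets_eq_balls)
      fix n c
      show "emeasure Q (zm_ball m n c) = emeasure P (zm_ball m n c)"
        using haar_probability_ball[OF m Q, of c n] haar_probability_ball[OF m hP, of c n]
        by (cases "c \<in> {0..<m ^ n}") (simp_all add: Q.emeasure_eq_measure P.emeasure_eq_measure zm_ball_outside)
    qed (rule P)
  qed
qed

lemma is_haar_haar_probability:
  "m > 1 \<Longrightarrow> is_haar_probability m (haar_probability m)"
  unfolding haar_probability_def by (rule theI'[OF ex1_haar_probability])


section \<open>Uniformity with each suffix\<close>

text \<open>Points of \<open>\<real>\<^sup>s\<close> are functions on the index set \<open>{1..s}\<close>, extended by \<open>undefined\<close> as in
  \<^term>\<open>Pi\<^sub>E\<close>.\<close>

definition phi :: "int \<Rightarrow> nat \<Rightarrow> (nat \<Rightarrow> (nat \<Rightarrow> int) \<Rightarrow> (nat \<Rightarrow> int)) \<Rightarrow> nat \<Rightarrow> (nat \<Rightarrow> int) \<Rightarrow> nat \<Rightarrow> real"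
  where "phi m s f n \<omega> = (\<lambda>i\<in>{1..s}. real_of_int (zm_mod (f i \<omega>) n) / real_of_int m ^ n)"

definition cube :: "int \<Rightarrow> nat \<Rightarrow> nat \<Rightarrow> (nat \<Rightarrow> int) \<Rightarrow> (nat \<Rightarrow> real) set" where
  "cube m s k a =
     (\<Pi>\<^sub>E i\<in>{1..s}. {real_of_int (a i) / real_of_int m ^ k ..< real_of_int (a i + 1) / real_of_int m ^ k})"

definition volume :: "nat \<Rightarrow> (nat \<Rightarrow> real) set \<Rightarrow> real" where
  "volume s A = measure (\<Pi>\<^sub>M i\<in>{1..s}. lborel) A"

text \<open>This is meant for collections of 1-Lipschitz maps, for which the events below are measurable.
  The power maps are 1-Lipschitz by \<open>zm_pow_one_lipschitz\<close>.\<close>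

definition uniform_with_each_suffix ::
  "int \<Rightarrow> nat \<Rightarrow> (nat \<Rightarrow> (nat \<Rightarrow> int) \<Rightarrow> (nat \<Rightarrow> int)) \<Rightarrow> bool" where
  "uniform_with_each_suffix m s f \<longleftrightarrow>
     (\<forall>k\<ge>1. \<forall>d\<ge>1. \<forall>a\<in>{1..s} \<rightarrow> {0..<m ^ k}. \<forall>\<beta>\<in>{0..<m ^ d}.
        (\<lambda>n. \<P>(\<omega> in haar_probability m. phi m s f n \<omega> \<in> cube m s k a \<bar> zm_mod \<omega> d = \<beta>))
          \<longlonglongrightarrow> volume s (cube m s k a))"

lemma volume_cube:
  assumes m: "m > 1"
  shows "volume s (cube m s k a) = 1 / real_of_int m ^ (k * s)"
proof -
  interpret product_sigma_finite "\<lambda>_::nat. lborel :: real measure" by unfold_locales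
  interpret finite_product_sigma_finite "\<lambda>_::nat. lborel :: real measure" "{1..s}"
    by unfold_locales auto
  have side: "emeasure lborel {real_of_int b / real_of_int m ^ k ..< real_of_int (b + 1) / real_of_int m ^ k}
      = ennreal (1 / real_of_int m ^ k)" for b
    using m by (subst emeasure_lborel_Ico) (auto simp: divide_right_mono simp flip: diff_divide_distrib)
  have "emeasure (\<Pi>\<^sub>M i\<in>{1..s}. lborel) (cube m s k a) = (\<Prod>i\<in>{1..s}. ennreal (1 / real_of_int m ^ k))"
    unfolding cube_def by (subst emeasure_PiM) (simp_all only: side, simp_all)
  also have "\<dots> = ennreal (1 / real_of_int m ^ (k * s))"
    using m by (simp add: ennreal_power power_one_over power_mult)
  finally show ?thesis using m by (simp add: volume_def measure_def)
qed

end

theory Submission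
  imports Defs "HOL-Computational_Algebra.Primes" "HOL-Computational_Algebra.Polynomial"
begin

text \<open>For \<open>n \<ge> d\<close> the conditional probability is a proportion: among the residues \<open>x\<close> modulo \<open>m ^ n\<close> with
  suffix \<open>\<beta>\<close>, count those for which the point with coordinates \<open>x ^ i / m ^ n\<close> modulo \<open>1\<close> lies in a given
  cube. By Weyl's criterion (\<open>weyl_criterion_cubes\<close>) these points are equidistributed among the cubes
  once, for every nonconstant integer polynomial \<open>P\<close>, the average of \<open>exp (2 \<pi> i P(x) / m ^ n)\<close> over
  the residues \<open>x\<close> with the given suffix tends to \<open>0\<close>.

  These exponential sums are treated by a \<open>p\<close>-adic analogue of stationary phase. Write \<open>x = u + m ^ j * t\<close> with \<open>j\<close> about
  \<open>n / 2\<close>. Modulo \<open>m ^ n\<close> the polynomial is affine in \<open>t\<close> with slope \<open>P'(u) * m ^ j\<close>, so the sum over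
  \<open>t\<close> vanishes unless \<open>m ^ (n - j)\<close> divides \<open>P'(u)\<close>
  (\<open>exponential_sum_stationary_bound\<close>). The density of such \<open>u\<close> tends to \<open>0\<close>: for a prime \<open>p\<close> dividing
  \<open>m\<close>, the approximate zeros of a nonzero polynomial cluster in at most as many classes modulo \<open>p ^ e\<close>
  as its degree (\<open>roots_mod_prime_power_in_few_classes\<close>), and \<open>e\<close> is arbitrary. Primality of \<open>p\<close> is
  essential in that step, as the ring of \<open>m\<close>-adic integers has zero divisors for general \<open>m\<close>.

  Weyl's criterion is obtained by bounding the indicator of a cube from above by a product of nonnegative
  trigonometric polynomials, built from Fejer kernels, whose mean is close to the volume of the cube
  (\<open>ex_trig_majorant\<close>). Since the proportions of all cubes add up to \<open>1\<close>, asymptotic upper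
  bounds for all of them force the limits.\<close>

section \<open>Additive characters\<close>

text \<open>The standard character \<open>t \<mapsto> exp (2 \<pi> i t)\<close> of the circle group \<open>\<real> / \<int>\<close>.\<close>

definition circle_char :: "real \<Rightarrow> complex"
  where "circle_char t = cis (2 * pi * t)"

lemma circle_char_0 [simp]: "circle_char 0 = 1"
  by (simp add: circle_char_def)

lemma circle_char_add: "circle_char (a + b) = circle_char a * circle_char b"
  by (simp add: circle_char_def cis_mult distrib_left)

lemma circle_char_minus: "circle_char (- a) = cnj (circle_char a)"
  by (simp add: circle_char_def cis_cnj)

lemma circle_char_sum: "circle_char (\<Sum>i\<in>I. f i) = (\<Prod>i\<in>I. circle_char (f i))"
  by (induction I rule: infinite_finite_induct) (simp_all add: circle_char_add)

lemma circle_char_power: "circle_char a ^ n = circle_char (real n * a)"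
  by (simp add: circle_char_def Complex.DeMoivre mult.left_commute)

lemma norm_circle_char [simp]: "norm (circle_char a) = 1"
  by (simp add: circle_char_def)

lemma circle_char_of_int [simp]: "circle_char (real_of_int a) = 1"
  by (simp add: circle_char_def)

lemma circle_char_eq_1D: "circle_char a = 1 \<Longrightarrow> a \<in> \<int>"
  by (auto simp: circle_char_def cis_conv_exp exp_eq_1)

lemma circle_char_cong:
  assumes "a - b \<in> \<int>" shows "circle_char a = circle_char b"
proof -
  obtain k where "a = b + of_int k"
    using assms by (elim Ints_cases) (auto simp: algebra_simps)
  then show ?thesis by (simp add: circle_char_add)
qed

lemma sum_circle_char_conv_power:
  "(\<Sum>t\<in>{0..<L::int}. circle_char (real_of_int t * x)) = (\<Sum>i<nat L. circle_char x ^ i)"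
proof -
  have "{0..<L} = int ` {..<nat L}"
    by (cases "L \<ge> 0") (simp_all add: image_atLeastZeroLessThan_int lessThan_atLeast0)
  then show ?thesis
    by (simp add: sum.reindex circle_char_power)
qed

text \<open>Orthogonality of the characters of \<open>\<int> / L \<int>\<close>. It is used twice: to see that the exponential sums
  cancel away from the critical points, and to see that the translated kernels below add up to \<open>1\<close>.\<close>

lemma sum_circle_char:
  fixes L h :: int
  assumes L: "L > 0"
  shows "(\<Sum>t\<in>{0..<L}. circle_char (real_of_int (h * t) / L)) = (if L dvd h then of_int L else 0)"
proof -
  let ?w = "circle_char (h / L)"
  have S: "(\<Sum>t\<in>{0..<L}. circle_char (real_of_int (h * t) / L)) = (\<Sum>i<nat L. ?w ^ i)"
    using sum_circle_char_conv_power[of "h / L" L] by (simp add: mult_ac)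
  show ?thesis
  proof (cases "L dvd h")
    case True
    then have "real_of_int h / L = of_int (h div L)" by (simp add: real_of_int_div)
    then have "?w = 1" by (metis circle_char_of_int)
    then show ?thesis using S True L by simp
  next
    case False
    have "?w \<noteq> 1"
    proof
      assume "?w = 1"
      from circle_char_eq_1D[OF this] obtain k where "real_of_int h / L = of_int k"
        by (auto elim: Ints_cases)
      then have "real_of_int h = of_int (k * L)" using L by (simp add: field_simps)
      then have "h = k * L" by linarith
      with False show False by simp
    qed
    moreover have "?w ^ nat L = 1" using L by (simp add: circle_char_power)
    ultimately show ?thesis using S False by (simp add: geometric_sum)
  qed
qed

section \<open>Zeros of integer polynomials modulo prime powers\<close>

text \<open>Splitting off the low base-\<open>A\<close> part \<open>u = x mod A\<close> from the high part \<open>t = x div A\<close>.\<close>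

lemma sum_residue_split:
  fixes A B :: int and f :: "int \<Rightarrow> 'a::comm_monoid_add"
  assumes A: "A > 0" and B: "B \<ge> 0"
  shows "(\<Sum>x\<in>{0..<A * B}. f x) = (\<Sum>u\<in>{0..<A}. \<Sum>t\<in>{0..<B}. f (u + A * t))"
proof -
  have bij: "bij_betw (\<lambda>(u, t). u + A * t) ({0..<A} \<times> {0..<B}) {0..<A * B}"
  proof (rule bij_betw_byWitness[where f' = "\<lambda>x. (x mod A, x div A)"])
    have "u + A * t < A * B" if "u < A" "t < B" for u t
    proof -
      have "A * (t + 1) \<le> A * B" using that A by (intro mult_left_mono) auto
      then show ?thesis using that by (simp add: algebra_simps)
    qed
    then show "(\<lambda>(u, t). u + A * t) ` ({0..<A} \<times> {0..<B}) \<subseteq> {0..<A * B}"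
      using A by auto
    have "x div A < B" if "x < A * B" for x
    proof (rule ccontr)
      assume "\<not> x div A < B"
      then have "A * B \<le> A * (x div A)" using A by (intro mult_left_mono) auto
      also have "\<dots> \<le> x" using A by (metis mult_div_mod_eq pos_mod_sign add_increasing2 order_refl)
      finally show False using that by simp
    qed
    then show "(\<lambda>x. (x mod A, x div A)) ` {0..<A * B} \<subseteq> {0..<A} \<times> {0..<B}"
      using A by (auto simp: pos_imp_zdiv_nonneg_iff)
  qed (use A in auto)
  have "(\<Sum>x\<in>{0..<A * B}. f x) = (\<Sum>(u, t)\<in>{0..<A} \<times> {0..<B}. f (u + A * t))"
    using sum.reindex_bij_betw[OF bij, of f] by (simp add: case_prod_beta)
  then show ?thesis by (simp add: sum.cartesian_product)
qed

lemma card_residues_in: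
  fixes q N :: int
  assumes q: "q > 0" and N: "N \<ge> 0" and C: "C \<subseteq> {0..<q}"
  shows "card {x\<in>{0..<q * N}. x mod q \<in> C} = card C * nat N"
proof -
  have "card {x\<in>{0..<q * N}. x mod q \<in> C} = (\<Sum>x\<in>{0..<q * N}. of_bool (x mod q \<in> C))"
    by (simp add: sum_of_bool_eq Int_def)
  also have "\<dots> = (\<Sum>u\<in>{0..<q}. \<Sum>t\<in>{0..<N}. of_bool (u \<in> C))"
    by (subst sum_residue_split[OF q N]) (auto intro!: sum.cong)
  also have "\<dots> = nat N * card ({0..<q} \<inter> C)"
    by (simp add: sum_of_bool_eq mult.commute flip: sum_distrib_left)
  also have "{0..<q} \<inter> C = C" using C by auto
  finally show ?thesis by (simp add: mult.commute)
qed

text \<open>The usual count of roots in a field, made approximate. Dividing by \<open>x - v\<close> for one root \<open>v\<close>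
  modulo \<open>p ^ l\<close>, any other root \<open>u\<close> either shares the class of \<open>v\<close> modulo \<open>p ^ e\<close>, or \<open>u - v\<close>
  absorbs fewer than \<open>e\<close> factors \<open>p\<close> and \<open>u\<close> is a root of the quotient modulo \<open>p ^ (l - e)\<close>.
  The quotient depends on \<open>v\<close>, and \<open>v\<close> on \<open>l\<close>; the induction goes through because the threshold \<open>L\<close>
  is uniform over all polynomials of given degree and leading coefficient, and the quotient
  has the same leading coefficient.\<close>

lemma roots_mod_prime_power_in_few_classes:
  fixes p c :: int
  assumes p: "prime p" and c: "c \<noteq> 0"
  shows "\<exists>L. \<forall>Q l. degree Q = r \<and> lead_coeff Q = c \<and> l \<ge> L \<longrightarrow>
    (\<exists>C. finite C \<and> card C \<le> r \<and> (\<forall>u. p ^ l dvd poly Q u \<longrightarrow> u mod p ^ e \<in> C))"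
proof (induction r)
  case 0
  have "\<not> p ^ l dvd c" if "l \<ge> nat \<bar>c\<bar>" for l
  proof
    assume "p ^ l dvd c"
    then have "p ^ l \<le> \<bar>c\<bar>" using c by (metis dvd_imp_le_int abs_ge_self order.trans)
    moreover have "p \<ge> 2" using p by (rule prime_ge_2_int)
    then have "2 ^ l \<le> p ^ l" by (intro power_mono) auto
    moreover have "int l < 2 ^ l" by (rule of_nat_less_two_power)
    ultimately show False using that by linarith
  qed
  then have "\<forall>u. \<not> p ^ l dvd poly Q u" if "degree Q = 0" "lead_coeff Q = c" "l \<ge> nat \<bar>c\<bar>" for Q l
    using that by (auto elim!: degree_eq_zeroE)
  then show ?case by (intro exI[of _ "nat \<bar>c\<bar>"]) (metis card.empty finite.emptyI order.refl)
next
  case (Suc r)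
  then obtain L where L: "\<And>Q l. degree Q = r \<Longrightarrow> lead_coeff Q = c \<Longrightarrow> l \<ge> L \<Longrightarrow>
    \<exists>C. finite C \<and> card C \<le> r \<and> (\<forall>u. p ^ l dvd poly Q u \<longrightarrow> u mod p ^ e \<in> C)" by blast
  show ?case
  proof (intro exI[of _ "L + e"] allI impI, elim conjE)
    fix Q l assume Q: "degree Q = Suc r" "lead_coeff Q = c" and l: "l \<ge> L + e"
    show "\<exists>C. finite C \<and> card C \<le> Suc r \<and> (\<forall>u. p ^ l dvd poly Q u \<longrightarrow> u mod p ^ e \<in> C)"
    proof (cases "\<exists>v. p ^ l dvd poly Q v")
      case False
      then show ?thesis by (intro exI[of _ "{}"]) auto
    next
      case True
      then obtain v where v: "p ^ l dvd poly Q v" by blast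
      define R where "R = synthetic_div Q v"
      have QR: "Q = [:-v, 1:] * R + [:poly Q v:]"
        unfolding R_def by (rule synthetic_div_correct'[symmetric])
      have dR: "degree R = r" using Q by (simp add: R_def degree_synthetic_div)
      have "coeff Q (Suc r) = coeff R r"
        by (subst QR) (simp add: coeff_eq_0 dR)
      then have lR: "lead_coeff R = c" using Q dR by simp
      obtain C where C: "finite C" "card C \<le> r" "\<And>u. p ^ (l - e) dvd poly R u \<Longrightarrow> u mod p ^ e \<in> C"
        using L[OF dR lR, of "l - e"] l by (metis le_diff_conv2 add_leE)
      have "u mod p ^ e \<in> insert (v mod p ^ e) C" if u: "p ^ l dvd poly Q u" for u
      proof (cases "p ^ e dvd u - v")
        case True
        then show ?thesis by (simp add: mod_eq_dvd_iff)
      next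
        case False
        have "poly Q u = (u - v) * poly R u + poly Q v"
          by (subst QR) (simp add: algebra_simps)
        then have "p ^ l dvd (u - v) * poly R u" using u v by (metis add_diff_cancel_right' dvd_diff)
        then have "p ^ e dvd u - v \<or> p ^ (Suc l - e) dvd poly R u"
          by (rule prime_elem_power_dvd_cases) (use l p in auto)
        then have "p ^ (l - e) dvd poly R u" using False
          by (metis Suc_n_not_le_n diff_le_mono dvd_trans le_imp_power_dvd linorder_le_cases)
        then show ?thesis using C by blast
      qed
      moreover have "card (insert (v mod p ^ e) C) \<le> Suc r"
        using C(1,2) by (simp add: card_insert_if)
      ultimately show ?thesis using C(1) by (intro exI[of _ "insert (v mod p ^ e) C"]) auto
    qed
  qed
qed

text \<open>Roots modulo \<open>m ^ l\<close> are roots modulo \<open>p ^ l\<close> for any prime \<open>p\<close> dividing \<open>m\<close>, hence lie in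
  \<open>degree Q\<close> of the \<open>p ^ e\<close> classes modulo \<open>p ^ e\<close>, and \<open>e\<close> may be as large as desired.\<close>

lemma density_roots_mod_power_small:
  fixes m :: int and Q :: "int poly" and \<epsilon> :: real
  assumes m: "m > 1" and Q: "Q \<noteq> 0" and eps: "\<epsilon> > 0"
  shows "\<exists>L. \<forall>l\<ge>L. \<forall>j\<ge>l. real (card {u\<in>{0..<m ^ j}. m ^ l dvd poly Q u}) \<le> \<epsilon> * m ^ j"
proof -
  obtain p where p: "prime p" "p dvd m" using m by (metis prime_factor_int abs_of_pos less_trans not_less_iff_gr_or_eq zero_less_one)
  have p2: "p \<ge> 2" using p(1) by (rule prime_ge_2_int)
  obtain e where e: "real (degree Q) / \<epsilon> < 2 ^ e"
    using real_arch_pow[of 2 "real (degree Q) / \<epsilon>"] by auto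
  have pe: "real (degree Q) \<le> \<epsilon> * p ^ e"
  proof -
    have "(2::real) ^ e \<le> of_int p ^ e" using p2 by (intro power_mono) auto
    then have "real (degree Q) / \<epsilon> \<le> of_int p ^ e" using e by linarith
    then show ?thesis using eps by (simp add: field_simps)
  qed
  obtain L where L: "\<And>l. l \<ge> L \<Longrightarrow>
    \<exists>C. finite C \<and> card C \<le> degree Q \<and> (\<forall>u. p ^ l dvd poly Q u \<longrightarrow> u mod p ^ e \<in> C)"
    using roots_mod_prime_power_in_few_classes[OF p(1), of "lead_coeff Q" "degree Q" e] Q by auto
  show "\<exists>L. \<forall>l\<ge>L. \<forall>j\<ge>l. real (card {u\<in>{0..<m ^ j}. m ^ l dvd poly Q u}) \<le> \<epsilon> * m ^ j"
  proof (intro exI[of _ "max L e"] allI impI)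
    fix l j assume l: "max L e \<le> l" and j: "l \<le> j"
    obtain C where C: "finite C" "card C \<le> degree Q" "\<And>u. p ^ l dvd poly Q u \<Longrightarrow> u mod p ^ e \<in> C"
      using L[of l] l by auto
    define C' where "C' = C \<inter> {0..<p ^ e}"
    have pe0: "p ^ e > 0" using p2 by simp
    have "p ^ e dvd m ^ j" using p(2) l j by (meson dvd_power_le dvd_trans le_imp_power_dvd max.boundedE order.trans)
    then obtain N where N: "m ^ j = p ^ e * N" by auto
    moreover have "m ^ j > 0" using m by simp
    ultimately have N0: "N \<ge> 0" using pe0 by (metis less_imp_le zero_less_mult_pos)
    have "{u\<in>{0..<m ^ j}. m ^ l dvd poly Q u} \<subseteq> {x\<in>{0..<p ^ e * N}. x mod p ^ e \<in> C'}"
    proof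
      fix u assume "u \<in> {u\<in>{0..<m ^ j}. m ^ l dvd poly Q u}"
      then have u: "u \<in> {0..<m ^ j}" "m ^ l dvd poly Q u" by auto
      have "p ^ l dvd poly Q u" using u(2) p(2) by (meson dvd_power_same dvd_trans)
      then show "u \<in> {x\<in>{0..<p ^ e * N}. x mod p ^ e \<in> C'}" using C(3) u(1) N pe0 by (auto simp: C'_def)
    qed
    then have "card {u\<in>{0..<m ^ j}. m ^ l dvd poly Q u} \<le> card {x\<in>{0..<p ^ e * N}. x mod p ^ e \<in> C'}"
      by (rule card_mono[rotated]) (rule finite_subset[OF Collect_restrict], simp)
    also have "\<dots> = card C' * nat N"
      by (rule card_residues_in) (auto simp: pe0 N0 C'_def)
    also have "card C' \<le> degree Q"
      using C(1,2) card_mono[of C C'] by (auto simp: C'_def)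
    finally have "real (card {u\<in>{0..<m ^ j}. m ^ l dvd poly Q u}) \<le> real (degree Q * nat N)"
      by (simp only: of_nat_le_iff mult_right_mono)
    also have "\<dots> \<le> \<epsilon> * p ^ e * N"
      using mult_right_mono[OF pe, of "of_int N"] N0 by simp
    also have "\<dots> = \<epsilon> * m ^ j" by (simp add: N flip: of_int_power)
    finally show "real (card {u\<in>{0..<m ^ j}. m ^ l dvd poly Q u}) \<le> \<epsilon> * m ^ j" .
  qed
qed

section \<open>Complete exponential sums\<close>

lemma poly_add_first_order:
  fixes Q :: "'a::idom poly"
  shows "\<exists>r. poly Q (u + h) = poly Q u + h * poly (pderiv Q) u + h\<^sup>2 * r"
proof (induction Q)
  case (pCons a Q)
  then obtain r where r: "poly Q (u + h) = poly Q u + h * poly (pderiv Q) u + h\<^sup>2 * r" by blast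
  show ?case
    by (rule exI[of _ "(u + h) * r + poly (pderiv Q) u"])
       (simp only: r poly_pCons pderiv_pCons poly_add, simp add: algebra_simps power2_eq_square)
qed simp

text \<open>Stationary phase. Put \<open>x = u + m ^ j * t\<close>. Since \<open>2 * j \<ge> j + l\<close>, only the first-order Taylor term
  in \<open>m ^ j * t\<close> survives modulo \<open>m ^ (j + l)\<close>, so the sum over \<open>t\<close> is that of the character with
  frequency \<open>P'(u)\<close> modulo \<open>m ^ l\<close>. It vanishes unless \<open>u\<close> is a critical point of \<open>P\<close> modulo \<open>m ^ l\<close>.
  Because \<open>d \<le> j\<close>, the condition on the suffix concerns \<open>u\<close> alone.\<close>

lemma exponential_sum_stationary_bound:
  fixes m :: int and P :: "int poly"
  assumes m: "m > 1" and lj: "l \<le> j" and d: "d \<le> j"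
  shows "norm (\<Sum>x\<in>{x\<in>{0..<m ^ (j + l)}. x mod m ^ d = \<beta>}. circle_char (poly P x / m ^ (j + l)))
    \<le> real_of_int (m ^ l) * card {u\<in>{0..<m ^ j}. m ^ l dvd poly (pderiv P) u}"
proof -
  let ?g = "\<lambda>x. circle_char (poly P x / m ^ (j + l))"
  have mp: "m ^ i > 0" for i using m by simp
  have mp': "real_of_int m ^ i > 0" for i using m by simp
  have inner: "?g (u + m ^ j * t) = ?g u * circle_char (real_of_int (poly (pderiv P) u * t) / real_of_int (m ^ l))" for u t
  proof -
    obtain r where r: "poly P (u + m ^ j * t) = poly P u + m ^ j * t * poly (pderiv P) u + (m ^ j * t)\<^sup>2 * r"
      using poly_add_first_order by blast
    have "m ^ j = m ^ l * m ^ (j - l)" using lj by (simp flip: power_add)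
    then have sq: "(m ^ j * t)\<^sup>2 * r = m ^ (j + l) * (m ^ (j - l) * t\<^sup>2 * r)"
      by (simp add: power2_eq_square power_add)
    have "real_of_int (poly P (u + m ^ j * t)) / m ^ (j + l)
        = poly P u / m ^ (j + l) + real_of_int (poly (pderiv P) u * t) / real_of_int (m ^ l)
          + real_of_int (m ^ (j - l) * t\<^sup>2 * r)"
      unfolding r sq using m by (simp add: field_simps power_add)
    then show ?thesis by (simp only: circle_char_add circle_char_of_int mult_1_right)
  qed
  have md: "(u + m ^ j * t) mod m ^ d = u mod m ^ d" for u t
    using le_imp_power_dvd[OF d, of m] by (metis dvd_mult2 mod_add_right_eq add.right_neutral dvd_imp_mod_0)
  have "(\<Sum>x\<in>{x\<in>{0..<m ^ (j + l)}. x mod m ^ d = \<beta>}. ?g x)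
      = (\<Sum>x\<in>{0..<m ^ j * m ^ l}. if x mod m ^ d = \<beta> then ?g x else 0)"
    by (subst sum.inter_filter) (simp_all add: power_add)
  also have "\<dots> = (\<Sum>u\<in>{0..<m ^ j}. \<Sum>t\<in>{0..<m ^ l}. if u mod m ^ d = \<beta> then ?g (u + m ^ j * t) else 0)"
    using mp by (subst sum_residue_split) (simp_all add: md less_imp_le)
  also have "\<dots> = (\<Sum>u\<in>{0..<m ^ j}. if u mod m ^ d = \<beta> then
      ?g u * (if m ^ l dvd poly (pderiv P) u then of_int (m ^ l) else 0) else 0)"
    unfolding inner using sum_circle_char[OF mp] by (intro sum.cong refl) (simp flip: sum_distrib_left)
  also have "norm \<dots> \<le> (\<Sum>u\<in>{0..<m ^ j}. if m ^ l dvd poly (pderiv P) u then real_of_int (m ^ l) else 0)"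
    using m by (intro order.trans[OF norm_sum] sum_mono) (auto simp: norm_mult norm_power power_abs less_imp_le[OF mp'])
  also have "\<dots> = real_of_int (m ^ l) * card {u\<in>{0..<m ^ j}. m ^ l dvd poly (pderiv P) u}"
    by (subst sum.inter_filter[symmetric]) simp_all
  finally show ?thesis .
qed

text \<open>Taking \<open>l\<close> and \<open>j\<close> about half of \<open>n\<close>, the normalised sum is at most the density of the critical
  points modulo \<open>m ^ l\<close>, which tends to \<open>0\<close> because the derivative of \<open>P\<close> is a nonzero polynomial.\<close>

lemma exponential_sum_tendsto_0:
  fixes m :: int and P :: "int poly"
  assumes m: "m > 1" and P: "degree P > 0"
  shows "(\<lambda>n. (\<Sum>x\<in>{x\<in>{0..<m ^ n}. x mod m ^ d = \<beta>}. circle_char (poly P x / m ^ n)) / of_int (m ^ n))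
    \<longlonglongrightarrow> 0"
proof (rule LIMSEQ_I)
  fix \<epsilon> :: real assume "\<epsilon> > 0"
  then have e2: "\<epsilon> / 2 > 0" by simp
  have "pderiv P \<noteq> 0" using P by (simp add: pderiv_eq_0_iff)
  then obtain L where L: "\<And>l j. l \<ge> L \<Longrightarrow> j \<ge> l \<Longrightarrow>
      real (card {u\<in>{0..<m ^ j}. m ^ l dvd poly (pderiv P) u}) \<le> \<epsilon> / 2 * m ^ j"
    using density_roots_mod_power_small[OF m _ e2] by blast
  show "\<exists>n0. \<forall>n\<ge>n0. norm ((\<Sum>x\<in>{x\<in>{0..<m ^ n}. x mod m ^ d = \<beta>}.
      circle_char (poly P x / m ^ n)) / of_int (m ^ n) - 0) < \<epsilon>"
  proof (intro exI[of _ "2 * (L + d)"] allI impI)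
    fix n assume n: "2 * (L + d) \<le> n"
    define l where "l = n div 2"
    define j where "j = n - l"
    have lj: "l \<le> j" "d \<le> j" "L \<le> l" "n = j + l" using n by (auto simp: l_def j_def)
    have mp: "real_of_int m ^ i > 0" for i using m by simp
    let ?S = "\<Sum>x\<in>{x\<in>{0..<m ^ n}. x mod m ^ d = \<beta>}. circle_char (poly P x / m ^ n)"
    have "norm ?S \<le> real_of_int (m ^ l) * card {u\<in>{0..<m ^ j}. m ^ l dvd poly (pderiv P) u}"
      unfolding lj(4) by (rule exponential_sum_stationary_bound[OF m lj(1,2)])
    also have "\<dots> \<le> real_of_int (m ^ l) * (\<epsilon> / 2 * m ^ j)"
      using L[OF lj(3,1)] mp by (intro mult_left_mono) (auto simp: less_imp_le)
    also have "\<dots> = \<epsilon> / 2 * m ^ n" by (simp add: lj(4) power_add)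
    also have "\<dots> < \<epsilon> * m ^ n" using \<open>\<epsilon> > 0\<close> mp[of n] by simp
    finally show "norm (?S / of_int (m ^ n) - 0) < \<epsilon>"
      using mp[of n] m by (simp add: norm_divide norm_power pos_divide_less_eq)
  qed
qed

section \<open>Trigonometric majorants of intervals\<close>

definition fejer_kernel :: "int \<Rightarrow> real \<Rightarrow> real"
  where "fejer_kernel L x = (norm (\<Sum>j\<in>{0..<L}. circle_char (real_of_int j * x)))\<^sup>2 / (real_of_int L)\<^sup>2"

lemma fejer_kernel_nonneg: "fejer_kernel L x \<ge> 0"
  by (simp add: fejer_kernel_def)

lemma fejer_kernel_expand:
  "complex_of_real (fejer_kernel L x) =
    (\<Sum>(j, k)\<in>{0..<L} \<times> {0..<L}. circle_char (real_of_int (j - k) * x)) / (of_int L)\<^sup>2"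
proof -
  let ?D = "\<Sum>j\<in>{0..<L}. circle_char (real_of_int j * x)"
  have "complex_of_real ((norm ?D)\<^sup>2) = ?D * cnj ?D"
    by (rule complex_norm_square)
  also have "\<dots> = (\<Sum>j\<in>{0..<L}. \<Sum>k\<in>{0..<L}. circle_char (real_of_int j * x) * circle_char (- (real_of_int k * x)))"
    by (simp only: cnj_sum sum_product circle_char_minus)
  also have "\<dots> = (\<Sum>(j, k)\<in>{0..<L} \<times> {0..<L}. circle_char (real_of_int (j - k) * x))"
    by (simp add: sum.cartesian_product left_diff_distrib flip: circle_char_add)
  finally show ?thesis by (simp add: fejer_kernel_def)
qed

lemma fejer_kernel_bound:
  assumes "L > 0" "sin (pi * x) \<noteq> 0"
  shows "fejer_kernel L x \<le> 1 / (real_of_int L * sin (pi * x))\<^sup>2"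
proof -
  let ?w = "circle_char x"
  have d: "norm (?w - 1) = 2 * \<bar>sin (pi * x)\<bar>"
    using dist_exp_i_1[of "2 * pi * x"] by (simp add: circle_char_def cis_conv_exp)
  then have "?w \<noteq> 1" using assms by auto
  then have "norm (\<Sum>j\<in>{0..<L}. circle_char (real_of_int j * x)) = norm (?w ^ nat L - 1) / norm (?w - 1)"
    by (simp add: sum_circle_char_conv_power geometric_sum norm_divide)
  also have "\<dots> \<le> 2 / (2 * \<bar>sin (pi * x)\<bar>)"
    unfolding d using norm_triangle_ineq4[of "?w ^ nat L" 1]
    by (intro divide_right_mono) (simp_all add: norm_power)
  finally have "(norm (\<Sum>j\<in>{0..<L}. circle_char (real_of_int j * x)))\<^sup>2 \<le> (1 / \<bar>sin (pi * x)\<bar>)\<^sup>2"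
    by (intro power_mono) simp_all
  then have "fejer_kernel L x \<le> (1 / \<bar>sin (pi * x)\<bar>)\<^sup>2 / (real_of_int L)\<^sup>2"
    unfolding fejer_kernel_def by (rule divide_right_mono) simp
  then show ?thesis by (simp add: power_divide power_mult_distrib mult.commute)
qed

text \<open>The kernel of order \<open>L\<close> has frequencies strictly between \<open>- L\<close> and \<open>L\<close>, and averaging over the
  translates by multiples of \<open>1 / L\<close> kills every frequency that \<open>L\<close> does not divide. Only the constant
  term remains. The offset \<open>b\<close> lets the full period start at any node.\<close>

lemma fejer_kernel_partition:
  assumes L: "L > 0"
  shows "(\<Sum>r\<in>{0..<L}. fejer_kernel L (x - real_of_int (b + r) / L)) = 1"
proof -
  have "complex_of_real (\<Sum>r\<in>{0..<L}. fejer_kernel L (x - real_of_int (b + r) / L))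
     = (\<Sum>r\<in>{0..<L}. \<Sum>(j, k)\<in>{0..<L} \<times> {0..<L}.
          circle_char (real_of_int (j - k) * (x - b / L)) * circle_char (real_of_int ((k - j) * r) / L)) / (of_int L)\<^sup>2"
    unfolding of_real_sum fejer_kernel_expand
    by (simp add: case_prod_beta sum_divide_distrib diff_divide_distrib add_divide_distrib algebra_simps
        flip: circle_char_add)
  also have "(\<Sum>r\<in>{0..<L}. \<Sum>(j, k)\<in>{0..<L} \<times> {0..<L}.
          circle_char (real_of_int (j - k) * (x - b / L)) * circle_char (real_of_int ((k - j) * r) / L))
      = (\<Sum>(j, k)\<in>{0..<L} \<times> {0..<L}. circle_char (real_of_int (j - k) * (x - b / L)) *
          (if L dvd k - j then of_int L else 0))"
    unfolding case_prod_beta by (subst sum.swap) (simp only: sum_distrib_left[symmetric] sum_circle_char[OF L])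
  also have "\<dots> = (\<Sum>(j, k)\<in>{0..<L} \<times> {0..<L}. if k = j then of_int L else 0)"
  proof (intro sum.cong refl, clarify)
    fix j k assume jk: "j \<in> {0..<L}" "k \<in> {0..<L}"
    have "L dvd k - j \<longleftrightarrow> k = j"
    proof
      assume "L dvd k - j"
      then have "k mod L = j mod L" by (simp add: mod_eq_dvd_iff)
      then show "k = j" using jk by simp
    qed simp
    then show "circle_char (real_of_int (j - k) * (x - b / L)) * (if L dvd k - j then of_int L else 0) =
        (if k = j then of_int L else 0)" by simp
  qed
  also have "\<dots> = (of_int L)\<^sup>2"
    using L by (simp flip: sum.cartesian_product add: power2_eq_square)
  finally have "complex_of_real (\<Sum>r\<in>{0..<L}. fejer_kernel L (x - real_of_int (b + r) / L)) = 1"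
    using L by simp
  then show ?thesis by (simp only: of_real_eq_1_iff)
qed

text \<open>On an interval, the kernels centred at nodes within distance \<open>D / L\<close> of it carry almost all of the
  partition of unity: the at most \<open>L\<close> remaining ones are centred at circular distance at least \<open>D / L\<close>
  and each of them is \<open>O (1 / L\<^sup>2)\<close> there when \<open>D / L\<close> is fixed.\<close>

lemma fejer_kernel_sum_ge_on_interval:
  fixes T D M :: int
  assumes D: "D > 0" and L: "L > 0" and DL: "2 * D \<le> L"
    and x: "real_of_int a / L \<le> x" "x < real_of_int b / L"
  shows "1 - 1 / (L * (sin (pi * (D / L)))\<^sup>2)
    \<le> (\<Sum>r\<in>{a - D..b + D}. fejer_kernel L (x - real_of_int r / L))"
proof -
  let ?F = "\<lambda>r. fejer_kernel L (x - real_of_int r / L)"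
  define s where "s = sin (pi * (D / L))"
  have s0: "s > 0" unfolding s_def using D DL L by (intro sin_gt_zero) (auto simp: field_simps)
  have far: "?F r \<le> 1 / (L * s)\<^sup>2" if r: "b + D < r" "r < a - D + L" for r
  proof -
    define y where "y = r / L - x"
    have "real_of_int (b + D) / L \<le> r / L" "real_of_int r / L \<le> real_of_int (a - D + L) / L"
      using r L by (intro divide_right_mono; simp)+
    then have y: "D / L \<le> y" "y \<le> 1 - D / L" using x L by (simp_all add: y_def add_divide_distrib diff_divide_distrib)
    have half: "real_of_int D / L \<le> 1 / 2" using DL L by (simp add: field_simps)
    have "s \<le> sin (pi * y)"
    proof (cases "y \<le> 1 / 2")
      case True
      have "pi * (D / L) \<le> pi * y" "pi * y \<le> pi / 2"
        using mult_left_mono[OF y(1), of pi] mult_left_mono[OF True, of pi] by simp_all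
      then show ?thesis unfolding s_def using D L
        by (intro sin_monotone_2pi_le) (auto intro: order.trans[of _ 0])
    next
      case False
      have "s \<le> sin (pi * (1 - y))" unfolding s_def using y False D L half
        by (intro sin_monotone_2pi_le mult_left_mono)
           (auto simp: intro: order.trans[of _ 0])
      also have "\<dots> = sin (pi * y)" by (simp add: right_diff_distrib sin_diff)
      finally show ?thesis .
    qed
    moreover have "sin (pi * (x - r / L)) = - sin (pi * y)"
      by (simp add: y_def flip: sin_minus) (simp add: algebra_simps)
    ultimately have *: "s \<le> \<bar>sin (pi * (x - r / L))\<bar>" by simp
    then have "sin (pi * (x - r / L)) \<noteq> 0" using s0 by auto
    then have "?F r \<le> 1 / (L * sin (pi * (x - r / L)))\<^sup>2" by (rule fejer_kernel_bound[OF L])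
    also have "\<dots> \<le> 1 / (L * s)\<^sup>2"
    proof -
      have "s\<^sup>2 \<le> (sin (pi * (x - r / L)))\<^sup>2"
        using * s0 by (simp add: abs_le_square_iff[symmetric])
      then show ?thesis using s0 L unfolding power_mult_distrib
        by (intro divide_left_mono mult_left_mono mult_pos_pos) (auto intro: less_le_trans)
    qed
    finally show ?thesis .
  qed
  have "1 = (\<Sum>r\<in>{0..<L}. ?F (a - D + r))" by (rule fejer_kernel_partition[OF L, symmetric])
  also have "\<dots> = (\<Sum>r\<in>{a - D..<a - D + L}. ?F r)"
    by (rule sum.reindex_bij_witness[of _ "\<lambda>r. r - (a - D)" "\<lambda>r. a - D + r"]) auto
  also have "\<dots> \<le> (\<Sum>r\<in>{a - D..b + D} \<union> {b + D<..<a - D + L}. ?F r)"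
    by (rule sum_mono2) (auto simp: fejer_kernel_nonneg)
  also have "\<dots> = (\<Sum>r\<in>{a - D..b + D}. ?F r) + (\<Sum>r\<in>{b + D<..<a - D + L}. ?F r)"
    by (rule sum.union_disjoint) auto
  also have "(\<Sum>r\<in>{b + D<..<a - D + L}. ?F r) \<le> card {b + D<..<a - D + L} * (1 / (L * s)\<^sup>2)"
    by (rule sum_bounded_above) (use far in auto)
  also have "\<dots> \<le> L * (1 / (L * s)\<^sup>2)"
  proof (rule mult_right_mono)
    have "real_of_int a / L < real_of_int b / L" using x by linarith
    then have "a < b" using L by (simp add: divide_less_cancel)
    then show "real (card {b + D<..<a - D + L}) \<le> real_of_int L" using D L by simp
  qed simp
  also have "\<dots> = 1 / (L * s\<^sup>2)" using L by (simp add: power2_eq_square)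
  finally show ?thesis by (simp add: s_def)
qed

text \<open>The value \<open>q\<close> is the mean of \<open>p\<close> over a period, that is, its constant Fourier coefficient.\<close>

definition trig_majorant ::
  "real set \<Rightarrow> int set \<Rightarrow> (int \<Rightarrow> complex) \<Rightarrow> (real \<Rightarrow> real) \<Rightarrow> real \<Rightarrow> bool" where
  "trig_majorant J H c p q \<longleftrightarrow>
     finite H \<and> 0 \<in> H \<and> c 0 = of_real q \<and>
     (\<forall>x. of_real (p x) = (\<Sum>h\<in>H. c h * circle_char (real_of_int h * x))) \<and>
     (\<forall>x. p x \<ge> 0) \<and> (\<forall>x\<in>J. p x \<ge> 1)"

text \<open>Sum the Fejer kernels at the nodes in and near the interval and rescale to make up for the
  small loss \<open>\<tau>\<close>. Each kernel has mean \<open>1 / L\<close>, so the mean is the proportion of nodes used, which is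
  close to the length \<open>1 / M\<close>.\<close>

lemma ex_trig_majorant:
  fixes M a :: int
  assumes M: "M > 1" and eps: "\<epsilon> > 0"
  shows "\<exists>H c p q. trig_majorant {real_of_int a / M..<real_of_int (a + 1) / M} H c p q
    \<and> 0 \<le> q \<and> q \<le> 1 / M + \<epsilon>"
proof -
  obtain Q :: nat where Q: "Q > 0" "inverse (real Q) < \<epsilon> / 2" using reals_Archimedean2[of "2 / \<epsilon>"] eps
    by (metis ex_inverse_of_nat_less half_gt_zero)
  define s where "s = sin (pi * (1 / (real_of_int M * real Q)))"
  have "1 * 1 < real_of_int M * real Q" using M Q(1) by (intro mult_less_le_imp_less) auto
  then have s0: "s > 0" unfolding s_def by (intro sin_gt_zero) (simp_all add: field_simps)
  \<comment> \<open>With order \<open>L = M * Q * D\<close>, margin \<open>D\<close> nodes on either side and \<open>Q * D\<close> nodes to the interval, the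
    margin has the fixed width \<open>1 / (M * Q)\<close>; the next limit is that of the mean as \<open>D\<close> grows.\<close>
  have "(\<lambda>D. (real Q + 2 + 1 / real D) / (M * real Q) / (1 - 1 / real D * (1 / (M * real Q * s\<^sup>2))))
    \<longlonglongrightarrow> (real Q + 2 + 0) / (M * real Q) / (1 - 0 * (1 / (M * real Q * s\<^sup>2)))"
    by (intro tendsto_intros lim_1_over_n) (use M Q in auto)
  moreover have "(real Q + 2 + 0) / (M * real Q) / (1 - 0 * (1 / (M * real Q * s\<^sup>2))) < 1 / M + \<epsilon>"
  proof -
    have "(real Q + 2) / (M * real Q) = 1 / M + 2 * inverse (real Q) / M" using M Q by (simp add: field_simps)
    also have "2 * inverse (real Q) / M \<le> 2 * inverse (real Q)" using M Q by (simp add: field_simps)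
    finally show ?thesis using Q(2) by simp
  qed
  ultimately have ev1: "\<forall>\<^sub>F D in sequentially.
      (real Q + 2 + 1 / real D) / (M * real Q) / (1 - 1 / real D * (1 / (M * real Q * s\<^sup>2))) < 1 / M + \<epsilon>"
    by (rule order_tendstoD(2))
  have "(\<lambda>D. 1 / real D * (1 / (M * real Q * s\<^sup>2))) \<longlonglongrightarrow> 0 * (1 / (M * real Q * s\<^sup>2))"
    by (intro tendsto_intros lim_1_over_n)
  then have ev2: "\<forall>\<^sub>F D in sequentially. 1 / real D * (1 / (M * real Q * s\<^sup>2)) < 1"
    by (rule order_tendstoD(2)) simp
  obtain D :: nat where D: "D > 0" "1 / real D * (1 / (M * real Q * s\<^sup>2)) < 1"
      "(real Q + 2 + 1 / real D) / (M * real Q) / (1 - 1 / real D * (1 / (M * real Q * s\<^sup>2))) < 1 / M + \<epsilon>"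
    using eventually_happens'[OF sequentially_bot eventually_conj[OF eventually_gt_at_top[of 0] eventually_conj[OF ev2 ev1]]]
    by auto
  define L where "L = M * int Q * int D"
  define T where "T = int Q * int D"
  define R where "R = {a * T - int D..(a + 1) * T + int D}"
  define \<tau> where "\<tau> = 1 / real D * (1 / (M * real Q * s\<^sup>2))"
  have L0: "L > 0" using M Q D by (simp add: L_def)
  have \<tau>: "\<tau> < 1" using D by (simp add: \<tau>_def)
  define p where "p = (\<lambda>x. (\<Sum>r\<in>R. fejer_kernel L (x - real_of_int r / L)) / (1 - \<tau>))"
  define K where "K = R \<times> {0..<L} \<times> {0..<L}"
  define g where "g = (\<lambda>(r::int, j::int, k::int). j - k)"
  define b where "b = (\<lambda>(r::int, j, k). circle_char (real_of_int (j - k) * (- (real_of_int r / L))) / (of_int L)\<^sup>2 / complex_of_real (1 - \<tau>))"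
  define c where "c = (\<lambda>h. \<Sum>\<kappa>\<in>{\<kappa>\<in>K. g \<kappa> = h}. b \<kappa>)"
  define q where "q = real (card R) / L / (1 - \<tau>)"
  have K: "finite K" by (simp add: K_def R_def)
  have R0: "R \<noteq> {}" using D M Q by (auto simp: R_def T_def algebra_simps)
  have "trig_majorant {real_of_int a / M..<real_of_int (a + 1) / M} (g ` K) c p q"
    unfolding trig_majorant_def
  proof (intro conjI allI ballI)
    show "finite (g ` K)" using K by simp
    obtain r where "r \<in> R" using R0 by blast
    then have "(r, 0, 0) \<in> K" using L0 by (simp add: K_def)
    then show "0 \<in> g ` K" by (force simp: g_def)
    have "{\<kappa>\<in>K. g \<kappa> = 0} = (\<lambda>(r, j). (r, j, j)) ` (R \<times> {0..<L})"
      by (force simp: K_def g_def)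
    then have "c 0 = (\<Sum>(r, j)\<in>R \<times> {0..<L}. b (r, j, j))"
      by (simp add: c_def sum.reindex inj_on_def case_prod_beta)
    also have "\<dots> = of_real q"
      using L0 by (simp add: b_def case_prod_beta q_def card_cartesian_product power2_eq_square)
    finally show "c 0 = of_real q" .
    fix x
    show "p x \<ge> 0" using \<tau> by (simp add: p_def sum_nonneg fejer_kernel_nonneg)
    have "complex_of_real (p x) = (\<Sum>r\<in>R. \<Sum>(j, k)\<in>{0..<L} \<times> {0..<L}. b (r, j, k) * circle_char (real_of_int (j - k) * x))"
      by (simp add: p_def fejer_kernel_expand case_prod_beta sum_divide_distrib b_def right_diff_distrib
          flip: circle_char_add)
    also have "\<dots> = (\<Sum>\<kappa>\<in>K. b \<kappa> * circle_char (real_of_int (g \<kappa>) * x))"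
      by (simp add: K_def sum.cartesian_product g_def case_prod_beta)
    also have "\<dots> = (\<Sum>h\<in>g ` K. \<Sum>\<kappa>\<in>{\<kappa>\<in>K. g \<kappa> = h}. b \<kappa> * circle_char (real_of_int (g \<kappa>) * x))"
      by (rule sum.image_gen[OF K])
    also have "\<dots> = (\<Sum>h\<in>g ` K. c h * circle_char (real_of_int h * x))"
      by (auto simp: c_def sum_distrib_right intro!: sum.cong)
    finally show "complex_of_real (p x) = (\<Sum>h\<in>g ` K. c h * circle_char (real_of_int h * x))" .
  next
    fix x assume "x \<in> {real_of_int a / M..<real_of_int (a + 1) / M}"
    then have x: "real_of_int a / M \<le> x" "x < real_of_int (a + 1) / M" by simp_all
    have conv: "real_of_int z / M = real_of_int (z * T) / L" for z
      using D Q M by (simp add: L_def T_def)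
    have "2 * int D \<le> M * (int Q * int D)"
    proof -
      have "2 * int D \<le> M * int D" using M by (intro mult_right_mono) auto
      also have "\<dots> \<le> M * (int Q * int D)" using M Q(1) D(1) by (intro mult_left_mono) auto
      finally show ?thesis .
    qed
    then have "1 - 1 / (L * (sin (pi * (int D / L)))\<^sup>2) \<le> (\<Sum>r\<in>R. fejer_kernel L (x - real_of_int r / L))"
      unfolding R_def using D L0 x
      by (intro fejer_kernel_sum_ge_on_interval) (simp_all only: conv[symmetric], simp_all add: L_def mult_ac)
    moreover have "1 / (L * (sin (pi * (int D / L)))\<^sup>2) = \<tau>"
      using D by (simp add: \<tau>_def s_def L_def mult_ac)
    ultimately show "p x \<ge> 1" using \<tau> by (simp add: p_def le_divide_eq)
  qed
  moreover have "q \<ge> 0" using \<tau> L0 by (simp add: q_def)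
  moreover have "q \<le> 1 / M + \<epsilon>"
  proof -
    have "(a + 1) * T + int D - (a * T - int D) + 1 = T + 2 * int D + 1" by (simp add: algebra_simps)
    then have "real (card R) = T + 2 * D + 1" using D by (simp add: R_def T_def)
    then have "real (card R) / L = (real Q + 2 + 1 / real D) / (M * real Q)"
      using D Q M by (simp add: L_def T_def field_simps)
    then show ?thesis using D(3) by (simp add: q_def \<tau>_def)
  qed
  ultimately show ?thesis by blast
qed

section \<open>Weyl's criterion for cubes\<close>

text \<open>Upper bounds suffice for equidistribution among finitely many cells: a cell with too little mass would
  force too much mass on the others.\<close>

lemma equidistributed_cells_if_upper:
  fixes F :: "'b \<Rightarrow> nat \<Rightarrow> real"
  assumes A: "finite A" and a: "a \<in> A"
    and total: "\<forall>\<^sub>F n in sequentially. (\<Sum>b\<in>A. F b n) = 1"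
    and upper: "\<And>b \<epsilon>. b \<in> A \<Longrightarrow> \<epsilon> > 0 \<Longrightarrow> \<forall>\<^sub>F n in sequentially. F b n < 1 / card A + \<epsilon>"
  shows "F a \<longlonglongrightarrow> 1 / card A"
proof (rule order_tendstoI)
  fix y assume "y > 1 / real (card A)"
  then show "\<forall>\<^sub>F n in sequentially. F a n < y" using upper[OF a, of "y - 1 / card A"] by simp
next
  fix y assume y: "y < 1 / real (card A)"
  have cA: "card A > 0" using A a by (auto simp: card_gt_0_iff)
  define \<epsilon> where "\<epsilon> = (1 / card A - y) / card A"
  have "\<epsilon> > 0" using y cA by (simp add: \<epsilon>_def)
  then have "\<forall>\<^sub>F n in sequentially. \<forall>b\<in>A. F b n < 1 / card A + \<epsilon>"
    using A upper by (simp add: eventually_ball_finite)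
  with total show "\<forall>\<^sub>F n in sequentially. y < F a n"
  proof eventually_elim
    case (elim n)
    have "1 = F a n + (\<Sum>b\<in>A - {a}. F b n)" using elim(1) A a by (simp add: sum.remove)
    also have "(\<Sum>b\<in>A - {a}. F b n) \<le> real (card (A - {a})) * (1 / card A + \<epsilon>)"
      using elim(2) by (intro sum_bounded_above) auto
    also have "\<dots> = (real (card A) - 1) * (1 / card A + \<epsilon>)"
      using A a cA by (simp add: of_nat_diff)
    also have "\<dots> = 1 - y - \<epsilon>"
      using cA by (simp add: \<epsilon>_def field_simps)
    finally show ?case using \<open>\<epsilon> > 0\<close> by simp
  qed
qed

text \<open>By the previous lemma only the mass of a cube has to be bounded above. Its indicator is at most
  the product of one-dimensional majorants, a finite combination of characters of the torus. In the limit
  only the trivial character contributes, leaving the product of the means.\<close>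

lemma weyl_criterion_cubes:
  fixes X :: "nat \<Rightarrow> 'a set" and \<theta> :: "nat \<Rightarrow> 'a \<Rightarrow> 'i \<Rightarrow> real" and M :: int
  assumes I: "finite I" and M: "M > 1"
    and X: "\<And>n. finite (X n)" "\<forall>\<^sub>F n in sequentially. X n \<noteq> {}"
    and range: "\<And>n x i. x \<in> X n \<Longrightarrow> i \<in> I \<Longrightarrow> 0 \<le> \<theta> n x i \<and> \<theta> n x i < 1"
    and weyl: "\<And>h :: 'i \<Rightarrow> int. \<exists>i\<in>I. h i \<noteq> 0 \<Longrightarrow>
      (\<lambda>n. (\<Sum>x\<in>X n. circle_char (\<Sum>i\<in>I. real_of_int (h i) * \<theta> n x i)) / card (X n)) \<longlonglongrightarrow> 0"
    and a: "a \<in> I \<rightarrow> {0..<M}"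
  shows "(\<lambda>n. card {x\<in>X n. \<forall>i\<in>I. real_of_int (a i) / M \<le> \<theta> n x i \<and> \<theta> n x i < real_of_int (a i + 1) / M}
      / card (X n)) \<longlonglongrightarrow> 1 / real_of_int M ^ card I"
proof -
  define S where "S = (\<lambda>b n. {x\<in>X n. \<forall>i\<in>I. real_of_int (b i) / M \<le> \<theta> n x i \<and> \<theta> n x i < real_of_int (b i + 1) / M})"
  define F where "F = (\<lambda>b n. real (card (S b n)) / card (X n))"
  define A where "A = (\<Pi>\<^sub>E i\<in>I. {0..<M})"
  have finA: "finite A" unfolding A_def using I by (intro finite_PiE) auto
  have cardA: "real (card A) = real_of_int M ^ card I" unfolding A_def using I M by (simp add: card_PiE)
  have aA: "restrict a I \<in> A" using a by (auto simp: A_def)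
  have total: "\<forall>\<^sub>F n in sequentially. (\<Sum>b\<in>A. F b n) = 1"
    using X(2)
  proof eventually_elim
    case (elim n)
    have "(\<Sum>b\<in>A. card (S b n)) = card (\<Union>b\<in>A. S b n)"
    proof (rule card_UN_disjoint[symmetric])
      show "\<forall>b\<in>A. finite (S b n)" using X(1) by (simp add: S_def)
      have "b = b'" if "b \<in> A" "b' \<in> A" "x \<in> S b n" "x \<in> S b' n" for b b' x
      proof (rule PiE_ext)
        show "b \<in> Pi\<^sub>E I (\<lambda>_. {0..<M})" "b' \<in> Pi\<^sub>E I (\<lambda>_. {0..<M})" using that by (simp_all add: A_def)
        fix i assume i: "i \<in> I"
        have "real_of_int (b i) < real_of_int (b' i + 1)" "real_of_int (b' i) < real_of_int (b i + 1)"
          using that(3,4) i M by (force simp: S_def field_simps)+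
        then show "b i = b' i" by linarith
      qed
      then show "\<forall>b\<in>A. \<forall>b'\<in>A. b \<noteq> b' \<longrightarrow> S b n \<inter> S b' n = {}" by blast
    qed (rule finA)
    also have "(\<Union>b\<in>A. S b n) = X n"
    proof
      show "X n \<subseteq> (\<Union>b\<in>A. S b n)"
      proof
        fix x assume x: "x \<in> X n"
        let ?b = "\<lambda>i\<in>I. \<lfloor>M * \<theta> n x i\<rfloor>"
        have "?b \<in> A" using range[OF x] M by (auto simp: A_def floor_less_iff)
        moreover have "x \<in> S ?b n" using x M by (auto simp: S_def field_simps) linarith+
        ultimately show "x \<in> (\<Union>b\<in>A. S b n)" by blast
      qed
    qed (auto simp: S_def)
    finally have "(\<Sum>b\<in>A. real (card (S b n))) = card (X n)" by (simp flip: of_nat_sum)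
    then show ?case using elim X(1)[of n] by (simp add: F_def flip: sum_divide_distrib)
  qed
  have upper: "\<forall>\<^sub>F n in sequentially. F b n < 1 / card A + \<epsilon>" if b: "b \<in> A" and eps: "\<epsilon> > 0" for b \<epsilon>
  proof -
    have "((\<lambda>\<eta>. (1 / real_of_int M + \<eta>) ^ card I) \<longlongrightarrow> (1 / real_of_int M + 0) ^ card I) (at_right 0)"
      by (intro tendsto_intros)
    then have "\<forall>\<^sub>F \<eta> in at_right 0. (1 / real_of_int M + \<eta>) ^ card I < 1 / card A + \<epsilon>"
      by (rule order_tendstoD(2)) (use eps in \<open>simp add: cardA power_one_over\<close>)
    then obtain \<eta> :: real where \<eta>: "\<eta> > 0" "(1 / real_of_int M + \<eta>) ^ card I < 1 / card A + \<epsilon>"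
      using eventually_happens'[OF trivial_limit_at_right_real
          eventually_conj[OF eventually_at_right_less[of 0]]] by blast
    obtain H :: "'i \<Rightarrow> int set" and c p q where maj: "\<And>i. trig_majorant
        {real_of_int (b i) / M..<real_of_int (b i + 1) / M} (H i) (c i) (p i) (q i)"
      and q: "\<And>i. 0 \<le> q i" "\<And>i. q i \<le> 1 / M + \<eta>"
    proof -
      have "\<forall>i. \<exists>H c p q. trig_majorant {real_of_int (b i) / M..<real_of_int (b i + 1) / M} H c p q
          \<and> 0 \<le> q \<and> q \<le> 1 / M + \<eta>"
        using ex_trig_majorant[OF M \<eta>(1)] by blast
      then show ?thesis using that by metis
    qed
    have H: "finite (H i)" "0 \<in> H i" "c i 0 = complex_of_real (q i)" "p i x \<ge> 0"
      "of_real (p i x) = (\<Sum>h\<in>H i. c i h * circle_char (real_of_int h * x))"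
      "real_of_int (b i) / M \<le> x \<Longrightarrow> x < real_of_int (b i + 1) / M \<Longrightarrow> p i x \<ge> 1" for i x
      using maj[of i] by (auto simp: trig_majorant_def)
    define G where "G = (\<lambda>n. (\<Sum>x\<in>X n. \<Prod>i\<in>I. p i (\<theta> n x i)) / card (X n))"
    have FG: "F b n \<le> G n" for n
    proof -
      have "real (card (S b n)) = (\<Sum>x\<in>S b n. 1)" by simp
      also have "\<dots> \<le> (\<Sum>x\<in>S b n. \<Prod>i\<in>I. p i (\<theta> n x i))"
        by (intro sum_mono prod_ge_1) (auto simp: S_def intro!: H(6))
      also have "\<dots> \<le> (\<Sum>x\<in>X n. \<Prod>i\<in>I. p i (\<theta> n x i))"
        by (intro sum_mono2 X(1) prod_nonneg) (auto simp: S_def H(4))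
      finally show ?thesis unfolding F_def G_def by (rule divide_right_mono) simp
    qed
    have expand: "complex_of_real (G n) = (\<Sum>h\<in>Pi\<^sub>E I H. (\<Prod>i\<in>I. c i (h i)) *
        ((\<Sum>x\<in>X n. circle_char (\<Sum>i\<in>I. real_of_int (h i) * \<theta> n x i)) / card (X n)))" for n
    proof -
      have "complex_of_real (G n) = (\<Sum>x\<in>X n. \<Prod>i\<in>I. \<Sum>h\<in>H i. c i h * circle_char (real_of_int h * \<theta> n x i)) / card (X n)"
        by (simp add: G_def H(5))
      also have "\<dots> = (\<Sum>x\<in>X n. \<Sum>h\<in>Pi\<^sub>E I H. (\<Prod>i\<in>I. c i (h i)) * circle_char (\<Sum>i\<in>I. real_of_int (h i) * \<theta> n x i)) / card (X n)"
        using I H(1) by (simp add: prod_sum_PiE prod.distrib circle_char_sum)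
      also have "\<dots> = (\<Sum>h\<in>Pi\<^sub>E I H. (\<Prod>i\<in>I. c i (h i)) * (\<Sum>x\<in>X n. circle_char (\<Sum>i\<in>I. real_of_int (h i) * \<theta> n x i))) / card (X n)"
        by (subst sum.swap) (simp add: sum_distrib_left)
      finally show ?thesis by (simp add: sum_divide_distrib[of _ "Pi\<^sub>E I H"])
    qed
    let ?z = "\<lambda>i\<in>I. 0 :: int"
    have lim: "(\<lambda>n. (\<Prod>i\<in>I. c i (h i)) *
        ((\<Sum>x\<in>X n. circle_char (\<Sum>i\<in>I. real_of_int (h i) * \<theta> n x i)) / card (X n)))
        \<longlonglongrightarrow> (if h = ?z then (\<Prod>i\<in>I. of_real (q i)) else 0)" if h: "h \<in> Pi\<^sub>E I H" for h
    proof (cases "h = ?z")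
      case True
      have "\<forall>\<^sub>F n in sequentially. (\<Prod>i\<in>I. c i (h i)) *
        ((\<Sum>x\<in>X n. circle_char (\<Sum>i\<in>I. real_of_int (h i) * \<theta> n x i)) / card (X n)) = (\<Prod>i\<in>I. of_real (q i))"
        using X(2) by eventually_elim (use X(1) True H(3) in simp)
      then show ?thesis using True by (simp add: tendsto_eventually)
    next
      case False
      then have "\<exists>i\<in>I. h i \<noteq> 0"
        using PiE_ext[OF h, of ?z] H(2) by force
      from tendsto_mult_right_zero[OF weyl[OF this]] show ?thesis using False by simp
    qed
    have "(\<lambda>n. complex_of_real (G n)) \<longlonglongrightarrow> (\<Sum>h\<in>Pi\<^sub>E I H. if h = ?z then (\<Prod>i\<in>I. of_real (q i)) else 0)"
      unfolding expand by (rule tendsto_sum) (rule lim)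
    also have "(\<Sum>h\<in>Pi\<^sub>E I H. if h = ?z then (\<Prod>i\<in>I. of_real (q i)) else 0) = complex_of_real (\<Prod>i\<in>I. q i)"
      using H(1,2) I by (subst sum.delta) (auto intro!: finite_PiE)
    finally have "G \<longlonglongrightarrow> (\<Prod>i\<in>I. q i)" by (simp only: tendsto_of_real_iff)
    moreover have "(\<Prod>i\<in>I. q i) < 1 / card A + \<epsilon>"
    proof -
      have "(\<Prod>i\<in>I. q i) \<le> (\<Prod>i\<in>I. 1 / M + \<eta>)" using q by (intro prod_mono) auto
      then show ?thesis using \<eta>(2) by simp
    qed
    ultimately have "\<forall>\<^sub>F n in sequentially. G n < 1 / card A + \<epsilon>" by (rule order_tendstoD(2))
    then show ?thesis by eventually_elim (use FG in \<open>rule le_less_trans\<close>)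
  qed
  have "F (restrict a I) \<longlonglongrightarrow> 1 / card A"
    by (rule equidistributed_cells_if_upper[OF finA aA total upper])
  moreover have "S (restrict a I) = S a" by (auto simp: S_def fun_eq_iff)
  ultimately show ?thesis by (simp add: F_def S_def cardA)
qed

section \<open>Uniformity of the power maps\<close>

lemma haar_prob_component_in:
  assumes m: "m > 1" and S: "S \<subseteq> {0..<m ^ n}"
  shows "measure (haar_probability m) {\<omega>\<in>space (haar_probability m). zm_mod \<omega> n \<in> S}
    = card S / real_of_int m ^ n"
proof -
  let ?P = "haar_probability m"
  have P: "is_haar_probability m ?P" by (rule is_haar_haar_probability[OF m])
  interpret prob_space ?P using P by (simp add: is_haar_probability_def)
  have sets: "zm_ball m n c \<in> sets ?P" for c
    using P by (simp add: is_haar_probability_def openin_zm_ball)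
  have "{\<omega>\<in>space ?P. zm_mod \<omega> n \<in> S} = (\<Union>c\<in>S. zm_ball m n c)"
    using P by (auto simp: is_haar_probability_def zm_ball_def)
  also have "measure ?P \<dots> = (\<Sum>c\<in>S. measure ?P (zm_ball m n c))"
    using sets S by (intro finite_measure_finite_Union)
      (auto simp: disjoint_family_on_def zm_ball_def intro: finite_subset)
  also have "\<dots> = (\<Sum>c\<in>S. 1 / real_of_int m ^ n)"
    using S by (intro sum.cong refl haar_probability_ball[OF m P]) auto
  finally show ?thesis by simp
qed

text \<open>For \<open>n \<ge> d\<close>, both the event and the condition depend on \<open>\<omega>\<close> only through its residue modulo
  \<open>m ^ n\<close>, which is uniformly distributed.\<close>

lemma cond_prob_cube_eq_card:
  fixes \<beta> :: int
  assumes m: "m > 1" and d: "d \<le> n"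
  defines "X \<equiv> {x\<in>{0..<m ^ n}. x mod m ^ d = \<beta>}"
  shows "\<P>(\<omega> in haar_probability m. phi m s (\<lambda>i x. x [^]\<^bsub>zm_ring m\<^esub> i) n \<omega> \<in> cube m s k a \<bar> zm_mod \<omega> d = \<beta>)
    = card {x\<in>X. \<forall>i\<in>{1..s}. real_of_int (a i) / real_of_int (m ^ k) \<le> real_of_int (x ^ i mod m ^ n) / real_of_int (m ^ n) \<and>
         real_of_int (x ^ i mod m ^ n) / real_of_int (m ^ n) < real_of_int (a i + 1) / real_of_int (m ^ k)} / card X"
    (is "_ = card ?S / _")
proof -
  let ?P = "haar_probability m"
  have sp: "space ?P = carrier (zm_ring m)"
    using is_haar_haar_probability[OF m] by (simp add: is_haar_probability_def)
  have comp: "\<omega> n \<in> {0..<m ^ n}" "zm_mod \<omega> d = \<omega> n mod m ^ d" if "\<omega> \<in> space ?P" for \<omega>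
    using that zm_carrierD[of \<omega> m n] zm_mod_mod[of \<omega> m d n] d by (auto simp: sp zm_mod_def)
  have "phi m s (\<lambda>i x. x [^]\<^bsub>zm_ring m\<^esub> i) n \<omega> \<in> cube m s k a \<and> zm_mod \<omega> d = \<beta> \<longleftrightarrow> zm_mod \<omega> n \<in> ?S"
    if w: "\<omega> \<in> space ?P" for \<omega>
    using comp[OF w] w unfolding sp
    by (auto simp: X_def phi_def cube_def zm_mod_def zm_pow[OF m] PiE_iff)
  then have num: "{\<omega>\<in>space ?P. phi m s (\<lambda>i x. x [^]\<^bsub>zm_ring m\<^esub> i) n \<omega> \<in> cube m s k a \<and> zm_mod \<omega> d = \<beta>}
      = {\<omega>\<in>space ?P. zm_mod \<omega> n \<in> ?S}" by blast
  have den: "{\<omega>\<in>space ?P. zm_mod \<omega> d = \<beta>} = {\<omega>\<in>space ?P. zm_mod \<omega> n \<in> X}"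
    using comp by (auto simp: X_def zm_mod_def)
  have S: "?S \<subseteq> {0..<m ^ n}" and X: "X \<subseteq> {0..<m ^ n}" by (auto simp: X_def)
  show ?thesis
    unfolding cond_prob_def num den haar_prob_component_in[OF m S] haar_prob_component_in[OF m X]
    using m by simp
qed

text \<open>A character of the torus with frequencies \<open>h\<close> evaluated at the point given by the powers
  of \<open>x\<close> is the exponential of the integer polynomial with coefficients \<open>h\<close>, since reducing the powers modulo
  \<open>m ^ n\<close> changes the argument by an integer. As the index set excludes \<open>0\<close>, a nonzero frequency gives a
  nonconstant polynomial.\<close>

lemma power_exponential_sum_tendsto_0:
  fixes m :: int and h :: "nat \<Rightarrow> int"
  assumes m: "m > 1" and h: "\<exists>i\<in>{1..s}. h i \<noteq> 0"
  shows "(\<lambda>n. (\<Sum>x\<in>{x\<in>{0..<m ^ n}. x mod m ^ d = \<beta>}.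
      circle_char (\<Sum>i\<in>{1..s}. real_of_int (h i) * (real_of_int (x ^ i mod m ^ n) / m ^ n))) / of_int (m ^ n))
    \<longlonglongrightarrow> 0"
proof -
  define P where "P = (\<Sum>i\<in>{1..s}. monom (h i) i)"
  obtain i where i: "i \<in> {1..s}" "h i \<noteq> 0" using h by blast
  have "coeff P i = h i" using i by (simp add: P_def coeff_sum)
  then have "degree P > 0" using i le_degree[of P i] by simp
  then have "(\<lambda>n. (\<Sum>x\<in>{x\<in>{0..<m ^ n}. x mod m ^ d = \<beta>}. circle_char (poly P x / m ^ n)) / of_int (m ^ n)) \<longlonglongrightarrow> 0"
    by (rule exponential_sum_tendsto_0[OF m])
  moreover have "circle_char (\<Sum>i\<in>{1..s}. real_of_int (h i) * (real_of_int (x ^ i mod m ^ n) / m ^ n))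
      = circle_char (poly P x / m ^ n)" for x n
  proof (rule circle_char_cong)
    have q: "real_of_int (x ^ i mod m ^ n) / m ^ n - real_of_int (x ^ i) / m ^ n = - real_of_int (x ^ i div m ^ n)" for i
    proof -
      have "real_of_int (x ^ i) = real_of_int (m ^ n) * real_of_int (x ^ i div m ^ n) + real_of_int (x ^ i mod m ^ n)"
        by (metis mult_div_mod_eq of_int_add of_int_mult)
      then show ?thesis using m by (simp add: field_simps)
    qed
    have "(\<Sum>i\<in>{1..s}. real_of_int (h i) * (real_of_int (x ^ i mod m ^ n) / m ^ n)) - poly P x / m ^ n
      = (\<Sum>i\<in>{1..s}. real_of_int (h i) * (real_of_int (x ^ i mod m ^ n) / m ^ n - real_of_int (x ^ i) / m ^ n))"
      by (simp add: P_def poly_sum poly_monom sum_divide_distrib right_diff_distrib sum_subtractf)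
    also have "\<dots> \<in> \<int>" unfolding q by (intro Ints_sum Ints_mult Ints_minus Ints_of_int)
    finally show "(\<Sum>i\<in>{1..s}. real_of_int (h i) * (real_of_int (x ^ i mod m ^ n) / m ^ n)) - poly P x / m ^ n \<in> \<int>" .
  qed
  ultimately show ?thesis by simp
qed

theorem theorem4:
  fixes m :: int and s :: nat
  assumes "m > 1" and "s \<ge> 1"
  shows "uniform_with_each_suffix m s (\<lambda>i x. x [^]\<^bsub>zm_ring m\<^esub> i)"
  unfolding uniform_with_each_suffix_def
proof (intro allI impI ballI)
  fix k d a \<beta>
  assume k: "1 \<le> k" and a: "a \<in> {1..s} \<rightarrow> {0..<m ^ k}" and \<beta>: "\<beta> \<in> {0..<m ^ d}"
  note m = \<open>m > 1\<close>
  define X where "X = (\<lambda>n. {x\<in>{0..<m ^ n}. x mod m ^ d = \<beta>})"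
  define \<theta> where "\<theta> = (\<lambda>n x i. real_of_int (x ^ i mod m ^ n) / m ^ n)"
  have cardX: "real (card (X n)) = real_of_int (m ^ n) / real_of_int (m ^ d)" if "d \<le> n" for n
  proof -
    have mn: "m ^ n = m ^ d * m ^ (n - d)" using that by (simp flip: power_add)
    have "card (X n) = nat (m ^ (n - d))"
      using card_residues_in[of "m ^ d" "m ^ (n - d)" "{\<beta>}"] m \<beta> by (simp add: X_def mn)
    then show ?thesis using m by (simp add: mn)
  qed
  have finX: "finite (X n)" for n by (rule finite_subset[of _ "{0..<m ^ n}"]) (auto simp: X_def)
  have X0: "\<forall>\<^sub>F n in sequentially. X n \<noteq> {}"
    using eventually_ge_at_top[of d]
  proof eventually_elim
    case (elim n)
    then have "real (card (X n)) \<noteq> 0" using cardX m by simp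
    then show ?case by auto
  qed
  have "(\<lambda>n. card {x\<in>X n. \<forall>i\<in>{1..s}. real_of_int (a i) / real_of_int (m ^ k) \<le> \<theta> n x i \<and>
      \<theta> n x i < real_of_int (a i + 1) / real_of_int (m ^ k)} / card (X n))
      \<longlonglongrightarrow> 1 / real_of_int (m ^ k) ^ card {1..s}"
  proof (rule weyl_criterion_cubes[OF _ _ finX X0 _ _ a])
    show "1 < m ^ k" using m k by simp
    show "0 \<le> \<theta> n x i \<and> \<theta> n x i < 1" for n x i
      using m by (simp add: \<theta>_def)
    fix h :: "nat \<Rightarrow> int" assume "\<exists>i\<in>{1..s}. h i \<noteq> 0"
    then have "(\<lambda>n. of_int (m ^ d) * ((\<Sum>x\<in>X n. circle_char (\<Sum>i\<in>{1..s}. real_of_int (h i) * \<theta> n x i)) / of_int (m ^ n))) \<longlonglongrightarrow> 0"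
      unfolding X_def \<theta>_def by (rule tendsto_mult_right_zero[OF power_exponential_sum_tendsto_0[OF m]])
    moreover have "\<forall>\<^sub>F n in sequentially. of_int (m ^ d) * ((\<Sum>x\<in>X n. circle_char (\<Sum>i\<in>{1..s}. real_of_int (h i) * \<theta> n x i)) / of_int (m ^ n))
      = (\<Sum>x\<in>X n. circle_char (\<Sum>i\<in>{1..s}. real_of_int (h i) * \<theta> n x i)) / card (X n)"
      using eventually_ge_at_top[of d]
    proof eventually_elim
      case (elim n)
      have "complex_of_nat (card (X n)) = complex_of_real (real (card (X n)))" by simp
      also have "\<dots> = of_int (m ^ n) / of_int (m ^ d)" unfolding cardX[OF elim] by simp
      finally show ?case by simp
    qed
    ultimately show "(\<lambda>n. (\<Sum>x\<in>X n. circle_char (\<Sum>i\<in>{1..s}. real_of_int (h i) * \<theta> n x i)) / card (X n)) \<longlonglongrightarrow> 0"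
      by (rule Lim_transform_eventually)
  qed simp
  moreover have "\<forall>\<^sub>F n in sequentially. card {x\<in>X n. \<forall>i\<in>{1..s}. real_of_int (a i) / real_of_int (m ^ k) \<le> \<theta> n x i \<and>
      \<theta> n x i < real_of_int (a i + 1) / real_of_int (m ^ k)} / card (X n)
    = \<P>(\<omega> in haar_probability m. phi m s (\<lambda>i x. x [^]\<^bsub>zm_ring m\<^esub> i) n \<omega> \<in> cube m s k a \<bar> zm_mod \<omega> d = \<beta>)"
    using eventually_ge_at_top[of d]
    by eventually_elim (simp only: cond_prob_cube_eq_card[OF m] X_def \<theta>_def)
  ultimately show "(\<lambda>n. \<P>(\<omega> in haar_probability m. phi m s (\<lambda>i x. x [^]\<^bsub>zm_ring m\<^esub> i) n \<omega> \<in> cube m s k a \<bar> zm_mod \<omega> d = \<beta>))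
      \<longlonglongrightarrow> volume s (cube m s k a)"
    unfolding volume_cube[OF m] by (simp add: Lim_transform_eventually power_mult)
qed

end
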